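(* Let $n,s$ be integers with $1\le s\le n-1$. A function $f:\mathbb F_{2^n}\to\mathbb F_{2^n}$ is $s$th order sum-free if and only if the code $C_s(f)$ (defined in the context) is a $[2^n,k,d]$ code over $\mathbb F_2$ with $$k\ge 2^n-n-\sum_{i=0}^{s-1}\binom ni$$ and $$d\ge\begin{cases}4&\text{if } s=1,\\ 2^s+2^{s-1}&\text{if } 2\le s\le n-2,\\ 2^n&\text{if } s=n-1.\end{cases}$$
   Context: A function $f:\mathbb F_{2^n}\to\mathbb F_{2^n}$ is called $s$th order sum-free if for every $s$-dimensional $\mathbb F_2$-affine subspace $A$ of $\mathbb F_{2^n}$ one has $\sum_{x\in A}f(x)\neq 0$. Identify $\mathbb F_{2^n}$ with the space of column vectors $\mathbb F_2^n$ via a fixed $\mathbb F_2$-basis, and list its elements as $x_0,\dots,x_{2^n-1}$. Every function $g:\mathbb F_2^n\to\mathbb F_2$ is uniquely represented by a polynomial in $\mathbb F_2[X_1,\dots,X_n]$ of degree at most $1$ in each variable; $\deg g$ denotes the total degree of this polynomial. The Reed-Muller code is $R(r,n)=\{g:\mathbb F_2^n\to\mathbb F_2:\deg g\le r\}$, each $g$ being identified with the vector $(g(x_0),\dots,g(x_{2^n-1}))\in\mathbb F_2^{2^n}$. Let $A_s$ be a generator matrix of $R(s-1,n)$ (its rows form a basis of $R(s-1,n)$), with columns indexed by $x_0,\dots,x_{2^n-1}$. For $f:\mathbb F_{2^n}\to\mathbb F_{2^n}$, $C_s(f)$ is the binary linear code of length $2^n$ with parity check matrix $$\begin{bmatrix}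 & A_s & \\ f(x_0)&\cdots&f(x_{2^n-1})\end{bmatrix},$$ where each $f(x_i)$ is regarded as a column vector in $\mathbb F_2^n$; that is, $C_s(f)$ is the set of $u\in\mathbb F_2^{2^n}$ such that this matrix times $u^T$ is $0$. An $[N,k,d]$ code is a linear code of length $N$, dimension $k$ and minimum (Hamming) weight $d$ of nonzero codewords. *)

theory Defs
  imports
    "HOL-Library.Cardinality"
    "HOL-Library.Z2"
    "HOL-Library.Poly_Mapping"
    "Jordan_Normal_Form.Matrix_Kernel"
begin

(* The prime field F_2 is the type bit. F_{2^n} is a type 'a :: {field, finite} with
   CARD('a) = 2 ^ n; F_2 acts on it through the embedding of_bit of F_2 into 'a.
   This action is a vector space structure only because 2 = 0 in such a field. *)

definition F2_scale :: "bit \<Rightarrow> 'a::field \<Rightarrow> 'a" where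
  "F2_scale c x = of_bit c * x"

definition F2_affine_subspace :: "nat \<Rightarrow> 'a::field set \<Rightarrow> bool" where
  "F2_affine_subspace s A \<longleftrightarrow>
     (\<exists>a V. Modules.module.subspace F2_scale V \<and> Vector_Spaces.vector_space.dim F2_scale V = s
            \<and> A = (\<lambda>v. a + v) ` V)"

definition sum_free_of_order :: "nat \<Rightarrow> ('a::{field, finite} \<Rightarrow> 'a) \<Rightarrow> bool" where
  "sum_free_of_order s f \<longleftrightarrow> (\<forall>A. F2_affine_subspace s A \<longrightarrow> (\<Sum>x\<in>A. f x) \<noteq> 0)"

definition ordered_F2_basis :: "nat \<Rightarrow> 'a::field list \<Rightarrow> bool" where
  "ordered_F2_basis n bs \<longleftrightarrow> length bs = n \<and> distinct bs
     \<and> \<not> Modules.module.dependent F2_scale (set bs)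
     \<and> Modules.module.span F2_scale (set bs) = UNIV"

definition coord_vec :: "'a::field list \<Rightarrow> 'a \<Rightarrow> bit vec" where
  "coord_vec bs y =
     vec (length bs) (\<lambda>i. Modules.module.representation F2_scale (set bs) y (bs ! i))"

(* A monomial is its exponent function (variable index to exponent), and a polynomial is the
   finitely supported function from monomials to coefficients. The variables are numbered
   0, ..., n - 1, matching the entries of vectors in carrier_vec n. *)

type_synonym F2_poly = "(nat \<Rightarrow>\<^sub>0 nat) \<Rightarrow>\<^sub>0 bit"

definition poly_eval :: "F2_poly \<Rightarrow> bit vec \<Rightarrow> bit" where
  "poly_eval p v =
     (\<Sum>m\<in>Poly_Mapping.keys p. Poly_Mapping.lookup p m
        * (\<Prod>i\<in>Poly_Mapping.keys m. (v $ i) ^ Poly_Mapping.lookup m i))"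

(* the zero polynomial is given degree 0 *)
definition total_deg :: "F2_poly \<Rightarrow> nat" where
  "total_deg p =
     Max (insert 0 ((\<lambda>m. \<Sum>i\<in>Poly_Mapping.keys m. Poly_Mapping.lookup m i)
       ` Poly_Mapping.keys p))"

definition reduced_poly :: "nat \<Rightarrow> F2_poly \<Rightarrow> bool" where
  "reduced_poly n p \<longleftrightarrow>
     (\<forall>m\<in>Poly_Mapping.keys p. Poly_Mapping.keys m \<subseteq> {..<n}
        \<and> (\<forall>i. Poly_Mapping.lookup m i \<le> 1))"

(* Functions on F_2^n are represented by functions on all of bit vec; only their values on
   carrier_vec n matter. *)
definition bool_fun_deg :: "nat \<Rightarrow> (bit vec \<Rightarrow> bit) \<Rightarrow> nat" where
  "bool_fun_deg n g =
     total_deg (THE p. reduced_poly n p \<and> (\<forall>v\<in>carrier_vec n. poly_eval p v = g v))"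

(* ps lists the points of F_2^n in the order that indexes the coordinates of the code. *)
definition reed_muller :: "nat \<Rightarrow> nat \<Rightarrow> bit vec list \<Rightarrow> bit vec set" where
  "reed_muller r n ps = {vec_of_list (map g ps) | g. bool_fun_deg n g \<le> r}"

(* VS N C is the F_2-vector space on the carrier C with the operations of F_2^N. *)
abbreviation VS :: "nat \<Rightarrow> bit vec set \<Rightarrow> (bit, bit vec) Module.module" where
  "VS N C \<equiv> (module_vec TYPE(bit) N)\<lparr>carrier := C\<rparr>"

definition linear_code :: "nat \<Rightarrow> bit vec set \<Rightarrow> bool" where
  "linear_code N C \<longleftrightarrow> VectorSpace.subspace class_ring C (module_vec TYPE(bit) N)"

definition generator_matrix :: "nat \<Rightarrow> bit vec set \<Rightarrow> bit mat \<Rightarrow> bool" where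
  "generator_matrix N C G \<longleftrightarrow> linear_code N C \<and> dim_col G = N \<and> distinct (rows G)
     \<and> VectorSpace.vectorspace.basis class_ring (VS N C) (set (rows G))"

definition hamming_weight :: "bit vec \<Rightarrow> nat" where
  "hamming_weight u = card {i. i < dim_vec u \<and> u $ i \<noteq> 0}"

definition is_code :: "nat \<Rightarrow> nat \<Rightarrow> nat \<Rightarrow> bit vec set \<Rightarrow> bool" where
  "is_code N k d C \<longleftrightarrow> linear_code N C
     \<and> VectorSpace.vectorspace.dim class_ring (VS N C) = k
     \<and> (\<exists>u\<in>C. u \<noteq> 0\<^sub>v N \<and> hamming_weight u = d)
     \<and> (\<forall>u\<in>C. u \<noteq> 0\<^sub>v N \<longrightarrow> d \<le> hamming_weight u)"

definition sum_free_code ::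
  "bit mat \<Rightarrow> 'a::field list \<Rightarrow> 'a list \<Rightarrow> ('a \<Rightarrow> 'a) \<Rightarrow> bit vec set" where
  "sum_free_code G bs xs f =
     mat_kernel (G @\<^sub>r mat_of_cols (length bs) (map (\<lambda>x. coord_vec bs (f x)) xs))"

end

theory Submission
  imports Defs "Jordan_Normal_Form.DL_Rank"
begin

text \<open>A word with support \<open>S\<close> is orthogonal to \<open>R(s - 1, n)\<close> iff every product of fewer than
  \<open>s\<close> affine coordinate functions sums to zero over \<open>S\<close>; say then that \<open>S\<close> vanishes to order
  \<open>s\<close>. Both halves of such a set cut by a hyperplane vanish to order \<open>s - 1\<close>, so \<open>|S| \<ge> 2\<^sup>s\<close>
  unless \<open>S\<close> is empty. If \<open>|S| < 2\<^sup>s + 2\<^sup>s\<^sup>-\<^sup>1\<close>, the smaller half of a proper cut is by induction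
  a coset of a subspace \<open>W\<close> of dimension \<open>s - 1\<close>. For \<open>w \<in> W\<close> the symmetric difference of
  \<open>S\<close> and \<open>w + S\<close> vanishes to order \<open>s + 1\<close> but has fewer than \<open>2\<^sup>s\<^sup>+\<^sup>1\<close> elements, so it is
  empty. Hence \<open>S\<close> is a union of cosets of \<open>W\<close>, by its size of exactly two, that is, an
  \<open>s\<close>-flat. Conversely flats of dimension \<open>s\<close> vanish to order \<open>s\<close>. So \<open>f\<close> is sum-free of order
  \<open>s\<close> iff no word of the code has such a small support; the sharper bounds for \<open>s = 1\<close> and
  \<open>s = n - 1\<close> come from parity and from passing to the complement of \<open>S\<close>.\<close>

section \<open>Sets on which low-degree polynomials sum to zero\<close>

(* Otherwise the simplifier rewrites sums and products of bits to parity conditions. *)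
declare add_bit_eq_xor [simp del] mult_bit_eq_and [simp del]

lemma bit_one_add_one [simp]: "1 + 1 = (0::bit)"
  by (simp add: add_bit_eq_xor)

lemma bit_add_self [simp]: "x + x = (0::bit)"
  by (cases x) simp_all

lemma bit_add_eq_0_iff [simp]: "x + y = (0::bit) \<longleftrightarrow> x = y"
  by (cases x; cases y) simp_all

lemma bit_add_eq_1_iff [simp]: "x + y = (1::bit) \<longleftrightarrow> x \<noteq> y"
  by (cases x; cases y) simp_all

lemma of_nat_bit_eq_0_iff: "(of_nat k :: bit) = 0 \<longleftrightarrow> even k"
  by (induction k) auto

text \<open>The common part is counted once in each sum and cancels in characteristic 2. This lets
  symmetric difference model addition of words and of polynomials.\<close>

lemma sum_sym_diff_bit:
  fixes h :: "'b \<Rightarrow> bit"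
  assumes "finite A" "finite B"
  shows "sum h (sym_diff A B) = sum h A + sum h B"
proof -
  have "sum h A = sum h (A \<inter> B) + sum h (A - B)"
    using assms by (intro sum.Int_Diff)
  moreover have "sum h B = sum h (A \<inter> B) + sum h (B - A)"
    using assms by (subst Int_commute, intro sum.Int_Diff)
  moreover have "sum h (sym_diff A B) = sum h (A - B) + sum h (B - A)"
    using assms by (intro sum.union_disjoint) auto
  moreover have "a + b = (c + a) + (c + b)" for a b c :: bit
    by (cases c) simp_all
  ultimately show ?thesis by metis
qed

(* Closure under negation is automatic in the groups considered below, where x + x = 0. *)
definition add_subgroup :: "'a::ab_group_add set \<Rightarrow> bool" where
  "add_subgroup W \<longleftrightarrow> 0 \<in> W \<and> (\<forall>x\<in>W. \<forall>y\<in>W. x + y \<in> W)"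

text \<open>The combinatorics below needs only a family of maps to \<open>bit\<close> that is closed
  under adding 1 and separates points. The term \<open>l 0\<close> makes the first law one for
  affine rather than linear maps.\<close>

locale affine_coordinates =
  fixes L :: "('a::{ab_group_add, finite} \<Rightarrow> bit) set"
  assumes affine: "l \<in> L \<Longrightarrow> l (x + y) = l x + l y + l 0"
    and add_one_mem: "l \<in> L \<Longrightarrow> (\<lambda>x. l x + 1) \<in> L"
    and separating: "x \<noteq> y \<Longrightarrow> \<exists>l\<in>L. l x \<noteq> l y"
begin

text \<open>The two copies of \<open>l x\<close> cancel, so \<open>l (x + x) = l 0\<close> for every
  \<open>l\<close>, and separation does the rest.\<close>

lemma add_self [simp]: "x + x = (0::'a)"
proof (rule ccontr)
  assume "x + x \<noteq> 0"
  then obtain l where "l \<in> L" "l (x + x) \<noteq> l 0" using separating by blast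
  then show False using affine[of l x x] by simp
qed

lemma add_self_left [simp]: "x + (x + y) = (y::'a)"
  by (simp flip: add.assoc)

lemma add_const_mem: "l \<in> L \<Longrightarrow> (\<lambda>x. l x + c) \<in> L"
  using add_one_mem by (cases c) simp_all

lemma translate_mem: "l \<in> L \<Longrightarrow> (\<lambda>x. l (v + x)) \<in> L"
proof -
  assume l: "l \<in> L"
  have "l (v + x) = l x + (l v + l 0)" for x
    using affine[OF l, of v x] by (simp add: ac_simps)
  then have *: "(\<lambda>x. l (v + x)) = (\<lambda>x. l x + (l v + l 0))" by blast
  show ?thesis unfolding * by (rule add_const_mem[OF l])
qed

section \<open>Vanishing sets under cuts and translations\<close>

abbreviation prod_eval :: "('a \<Rightarrow> bit) list \<Rightarrow> 'a \<Rightarrow> bit" where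
  "prod_eval ls x \<equiv> prod_list (map (\<lambda>l. l x) ls)"

text \<open>The empty product counts, so order 1 means even size, while order 0 imposes no
  condition.\<close>

definition vanishes :: "nat \<Rightarrow> 'a set \<Rightarrow> bool" where
  "vanishes s S \<longleftrightarrow> (\<forall>ls. set ls \<subseteq> L \<longrightarrow> length ls < s \<longrightarrow> (\<Sum>x\<in>S. prod_eval ls x) = 0)"

lemma vanishesD: "vanishes s S \<Longrightarrow> set ls \<subseteq> L \<Longrightarrow> length ls < s \<Longrightarrow> (\<Sum>x\<in>S. prod_eval ls x) = 0"
  by (simp add: vanishes_def)

lemma vanishes_mono: "vanishes s S \<Longrightarrow> t \<le> s \<Longrightarrow> vanishes t S"
  by (auto simp: vanishes_def)

lemma even_card_if_vanishes: "vanishes (Suc s) S \<Longrightarrow> even (card S)"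
  using vanishesD[of "Suc s" S "[]"] by (simp add: of_nat_bit_eq_0_iff)

text \<open>The indicator function of \<open>l x = c\<close> is \<open>l x + (c + 1)\<close>, again
  a member of \<open>L\<close>. Multiplying by it costs one factor, hence one order.\<close>

lemma vanishes_hyperplane:
  assumes "vanishes (Suc s) S" "l \<in> L"
  shows "vanishes s {x \<in> S. l x = c}"
  unfolding vanishes_def
proof (intro allI impI)
  fix ls assume ls: "set ls \<subseteq> L" "length ls < s"
  define m where "m = (\<lambda>x. l x + (c + 1))"
  have m: "m \<in> L" unfolding m_def by (rule add_const_mem[OF assms(2)])
  have "(\<Sum>x\<in>{x \<in> S. l x = c}. prod_eval ls x) = (\<Sum>x\<in>S. if l x = c then prod_eval ls x else 0)"
    by (rule sum.inter_filter) simp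
  also have "\<dots> = (\<Sum>x\<in>S. prod_eval (m # ls) x)"
  proof (rule sum.cong)
    fix x show "(if l x = c then prod_eval ls x else 0) = prod_eval (m # ls) x"
      by (cases "l x"; cases c) (simp_all add: m_def)
  qed simp
  also have "\<dots> = 0" using assms(1) ls m by (intro vanishesD[of "Suc s"]) auto
  finally show "(\<Sum>x\<in>{x \<in> S. l x = c}. prod_eval ls x) = 0" .
qed

text \<open>The derivative \<open>p x + p (v + x)\<close> of a product of at most \<open>s\<close>
  affine factors has degree below \<open>s\<close>, so it sums to zero over
  \<open>S\<close>.\<close>

lemma vanishes_sym_diff_translate:
  assumes "vanishes s S"
  shows "vanishes (Suc s) (sym_diff S ((+) v ` S))"
  unfolding vanishes_def
proof (intro allI impI)
  fix ls assume ls: "set ls \<subseteq> L" "length ls < Suc s"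
  \<comment> \<open>The list \<open>ms\<close> collects the shifted factors already processed. The
    bound on the joint length leaves fewer than \<open>s\<close> factors whenever one of them is
    dropped.\<close>
  have telescope: "(\<Sum>x\<in>S. prod_eval ms x * (prod_eval ls x + prod_eval ls (v + x))) = 0"
    if "set ls \<subseteq> L" "set ms \<subseteq> L" "length ls + length ms \<le> s" for ls ms
    using that
  proof (induction ls arbitrary: ms)
    case (Cons l ls)
    let ?m = "\<lambda>x. l (v + x)"
    have l: "l \<in> L" using Cons.prems by simp
    have c: "l (v + x) = l x + (l v + l 0)" for x
      using affine[OF l, of v x] by (simp add: ac_simps)
    \<comment> \<open>Here \<open>z\<close> is \<open>l x\<close>, \<open>d\<close> is the constant
      by which the shift changes \<open>l\<close>, and \<open>p\<close>, \<open>q\<close> are the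
      remaining product at \<open>x\<close> and at \<open>v + x\<close>. The first summand has lost
      a factor; the second has moved it to \<open>ms\<close>.\<close>
    have *: "m * (z * p + (z + d) * q) = d * (m * p) + ((z + d) * m) * (p + q)" for m z p q d :: bit
      by (cases z; cases p; cases q; cases d) simp_all
    have "(\<Sum>x\<in>S. prod_eval ms x * (prod_eval (l # ls) x + prod_eval (l # ls) (v + x)))
      = (\<Sum>x\<in>S. (l v + l 0) * prod_eval (ms @ ls) x
          + prod_eval (?m # ms) x * (prod_eval ls x + prod_eval ls (v + x)))"
      by (intro sum.cong refl) (simp only: c * list.map prod_list.Cons map_append prod_list.append)
    also have "\<dots> = (l v + l 0) * (\<Sum>x\<in>S. prod_eval (ms @ ls) x)
       + (\<Sum>x\<in>S. prod_eval (?m # ms) x * (prod_eval ls x + prod_eval ls (v + x)))"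
      unfolding sum.distrib sum_distrib_left ..
    also have "(\<Sum>x\<in>S. prod_eval (ms @ ls) x) = 0"
      using Cons.prems by (intro vanishesD[OF assms]) auto
    also have "(\<Sum>x\<in>S. prod_eval (?m # ms) x * (prod_eval ls x + prod_eval ls (v + x))) = 0"
      using Cons.prems translate_mem[OF l] by (intro Cons.IH) auto
    finally show ?case by simp
  qed simp
  let ?h = "prod_eval ls"
  have "sum ?h (sym_diff S ((+) v ` S)) = sum ?h S + sum ?h ((+) v ` S)"
    by (rule sum_sym_diff_bit) simp_all
  also have "sum ?h ((+) v ` S) = (\<Sum>x\<in>S. ?h (v + x))"
    by (simp add: sum.reindex comp_def)
  also have "sum ?h S + (\<Sum>x\<in>S. ?h (v + x)) = (\<Sum>x\<in>S. prod_eval [] x * (?h x + ?h (v + x)))"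
    by (simp add: sum.distrib)
  also have "\<dots> = 0" using ls by (intro telescope) auto
  finally show "sum ?h (sym_diff S ((+) v ` S)) = 0" .
qed

text \<open>A nonempty set of even size has two points, and a function separating them cuts the set
  into two nonempty hyperplane sections.\<close>

lemma vanishes_split:
  assumes "vanishes (Suc s) S" "S \<noteq> {}"
  shows "\<exists>A. A \<noteq> {} \<and> A \<subset> S \<and> vanishes s A \<and> vanishes s (S - A)"
proof -
  obtain x where x: "x \<in> S" using assms(2) by blast
  have "card S \<noteq> 1" using even_card_if_vanishes[OF assms(1)] by auto
  then have "S \<noteq> {x}" by auto
  then obtain y where y: "y \<in> S" "x \<noteq> y" using x by blast
  then obtain l where l: "l \<in> L" "l x \<noteq> l y" using separating by blast
  let ?A = "{z \<in> S. l z = l x}"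
  have "S - ?A = {z \<in> S. l z = l y}"
    using l(2) by (cases "l x"; cases "l y") auto
  then have "vanishes s (S - ?A)" using vanishes_hyperplane[OF assms(1) l(1)] by simp
  moreover have "vanishes s ?A" using vanishes_hyperplane[OF assms(1) l(1)] .
  moreover have "x \<in> ?A" "y \<notin> ?A" using x l(2) by simp_all
  ultimately show ?thesis using y(1) by (intro exI[of _ ?A]) auto
qed

lemma card_subset_Diff: "A \<subseteq> S \<Longrightarrow> card S = card A + card (S - A)" for S :: "'a set"
  by (simp add: card_Diff_subset card_mono)

section \<open>Small vanishing sets and flats\<close>

text \<open>This is the minimum distance of a Reed-Muller code: each half of a proper cut has at
  least half the claimed size by induction.\<close>

lemma card_ge_if_vanishes:
  assumes "vanishes s S" "S \<noteq> {}"
  shows "2 ^ s \<le> card S"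
  using assms
proof (induction s arbitrary: S)
  case 0
  then show ?case by (simp add: Suc_le_eq card_gt_0_iff)
next
  case (Suc s)
  obtain A where A: "A \<noteq> {}" "A \<subset> S" "vanishes s A" "vanishes s (S - A)"
    using vanishes_split[OF Suc.prems] by blast
  have "2 ^ s \<le> card A" "2 ^ s \<le> card (S - A)"
    using A by (auto intro!: Suc.IH)
  then show ?case using card_subset_Diff[of A S] A(2) by simp
qed

lemma add_left_image_Un_coset:
  "(+) a ` (W \<union> (+) (a + b) ` W) = (+) a ` W \<union> (+) b ` (W :: 'a set)"
  by (auto simp: image_Un image_image add.assoc)

text \<open>The bound is \<open>2 ^ s + 2 ^ (s - 1)\<close>, doubled to avoid the predecessor, so
  that the induction can start at \<open>s = 0\<close>.\<close>

lemma flat_if_vanishes: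
  assumes "vanishes s S" "S \<noteq> {}" "2 * card S < 3 * 2 ^ s"
  shows "\<exists>a W. add_subgroup W \<and> card W = 2 ^ s \<and> S = (+) a ` W"
  using assms
proof (induction s arbitrary: S)
  case 0
  then have "card S = 1" by (cases "card S") auto
  then obtain a where "S = {a}" by (auto simp: card_1_singleton_iff)
  then show ?case by (intro exI[of _ a] exI[of _ "{0}"]) (simp add: add_subgroup_def)
next
  case (Suc s)
  obtain B where B: "B \<noteq> {}" "B \<subset> S" "vanishes s B" "vanishes s (S - B)"
    using vanishes_split[OF Suc.prems(1,2)] by blast
  \<comment> \<open>If both halves failed, \<open>2 * card S\<close> would reach
    \<open>6 * 2 ^ s\<close>, which is \<open>3 * 2 ^ Suc s\<close>.\<close>
  have "2 * card B < 3 * 2 ^ s \<or> 2 * card (S - B) < 3 * 2 ^ s"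
    using card_subset_Diff[of B S] B(2) Suc.prems(3) by auto
  then obtain A where AS: "A \<subseteq> S" and "A \<noteq> S" and "A \<noteq> {}" "vanishes s A" "2 * card A < 3 * 2 ^ s"
    using B by (metis Diff_subset Diff_eq_empty_iff double_diff order_refl psubset_eq)
  then obtain a W where W: "add_subgroup W" "card W = 2 ^ s" and A: "A = (+) a ` W"
    using Suc.IH[of A] by blast
  have W0: "0 \<in> W" and Wadd: "x \<in> W \<Longrightarrow> y \<in> W \<Longrightarrow> x + y \<in> W" for x y
    using W(1) by (auto simp: add_subgroup_def)
  have card_coset: "card ((+) x ` W) = 2 ^ s" for x
    using W(2) by (simp add: card_image)
  have inv: "w + x \<in> S" if w: "w \<in> W" and x: "x \<in> S" for w x
  proof -
    let ?T = "(+) w ` S"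
    \<comment> \<open>Translation by \<open>w\<close> fixes the coset \<open>A\<close> of
      \<open>W\<close>, so \<open>S\<close> and its translate share at least \<open>2 ^ s\<close>
      points.\<close>
    have "A \<subseteq> S \<inter> ?T"
    proof
      fix y assume y: "y \<in> A"
      then obtain z where z: "z \<in> W" "y = a + z" unfolding A by blast
      have "y = w + (a + (w + z))" by (simp add: z add.left_commute)
      moreover have "a + (w + z) \<in> A" unfolding A using Wadd[OF w z(1)] by blast
      ultimately show "y \<in> S \<inter> ?T" using AS y by blast
    qed
    then have le: "2 ^ s \<le> card (S \<inter> ?T)"
      using card_mono[of "S \<inter> ?T" A] card_coset[of a] A by simp
    have "card S = card (S \<inter> ?T) + card (S - ?T)"
      by (rule card_Int_Diff) simp
    moreover have "card ?T = card (?T \<inter> S) + card (?T - S)"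
      by (rule card_Int_Diff) simp
    moreover have "?T \<inter> S = S \<inter> ?T" by blast
    moreover have "card ?T = card S" by (simp add: card_image)
    moreover have "card (sym_diff S ?T) = card (S - ?T) + card (?T - S)"
      by (rule card_Un_disjoint) auto
    \<comment> \<open>This size is \<open>2 * (card S - card (S \<inter> ?T))\<close>, which is
      below \<open>3 * 2 ^ Suc s - 2 * 2 ^ s = 4 * 2 ^ s\<close>.\<close>
    ultimately have "card (sym_diff S ?T) < 2 ^ Suc (Suc s)"
      using le Suc.prems(3) by simp
    then have "sym_diff S ?T = {}"
      using card_ge_if_vanishes[OF vanishes_sym_diff_translate[OF Suc.prems(1), of w]] by fastforce
    then have "?T \<subseteq> S" by blast
    then show ?thesis using x by blast
  qed
  obtain b where b: "b \<in> S" "b \<notin> A" using AS \<open>A \<noteq> S\<close> by blast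
  \<comment> \<open>Invariance under \<open>W\<close> puts the whole coset of a point of
    \<open>S\<close> into \<open>S\<close>, and distinct cosets are disjoint. The form with
    \<open>X\<close> serves both for \<open>A\<close> and for the coset of \<open>b\<close>.\<close>
  have coset: "(+) y ` W \<subseteq> S - X"
    if y: "y \<in> S" "y \<notin> X" and X: "X = (+) x ` W" for x y X
  proof
    fix z assume "z \<in> (+) y ` W"
    then obtain w where w: "w \<in> W" "z = y + w" by blast
    have "z \<in> S" using inv[OF w(1) y(1)] w(2) by (simp add: add.commute)
    moreover have "z \<notin> X"
    proof
      assume "z \<in> X"
      then obtain w' where "w' \<in> W" "y + w = x + w'" using w(2) X by blast
      then have "y = x + (w' + w)" by (metis add.assoc add_self add.right_neutral)
      then show False using y(2) X Wadd[OF \<open>w' \<in> W\<close> w(1)] by blast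
    qed
    ultimately show "z \<in> S - X" by blast
  qed
  have bS: "(+) b ` W \<subseteq> S - A" using coset[OF b A] .
  have "S = A \<union> (+) b ` W"
  proof (rule ccontr)
    \<comment> \<open>A third coset would already give \<open>S\<close> at least
      \<open>3 * 2 ^ s\<close> elements.\<close>
    assume "S \<noteq> A \<union> (+) b ` W"
    then obtain d where d: "d \<in> S" "d \<notin> A" "d \<notin> (+) b ` W" using AS bS by blast
    have dS: "(+) d ` W \<subseteq> S - A" "(+) d ` W \<subseteq> S - (+) b ` W"
      using coset[OF d(1,2) A] coset[OF d(1,3) refl] by blast+
    have "card (A \<union> ((+) b ` W \<union> (+) d ` W)) = card A + card ((+) b ` W \<union> (+) d ` W)"
      using bS dS by (intro card_Un_disjoint) auto
    also have "card ((+) b ` W \<union> (+) d ` W) = card ((+) b ` W) + card ((+) d ` W)"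
      using dS by (intro card_Un_disjoint) auto
    finally have "card (A \<union> ((+) b ` W \<union> (+) d ` W)) = 3 * 2 ^ s"
      using card_coset A by simp
    moreover have "card (A \<union> ((+) b ` W \<union> (+) d ` W)) \<le> card S"
      using AS bS dS by (intro card_mono) auto
    ultimately show False using Suc.prems(3) by simp
  qed
  \<comment> \<open>Seen from the base point \<open>a\<close>, the coset of \<open>b\<close> has
    offset \<open>a + b\<close>, because \<open>a + (a + b) = b\<close>.\<close>
  define W' where "W' = W \<union> (+) (a + b) ` W"
  have SW: "S = (+) a ` W'"
    unfolding W'_def add_left_image_Un_coset using \<open>S = A \<union> (+) b ` W\<close> A by simp
  have "card S = card A + card ((+) b ` W)"
    using bS \<open>S = A \<union> (+) b ` W\<close> card_Un_disjoint[of A "(+) b ` W"] by fastforce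
  then have "card W' = 2 ^ Suc s"
    using card_coset A SW by (simp add: card_image)
  moreover have "add_subgroup W'"
    unfolding add_subgroup_def
  proof (intro conjI ballI)
    show "0 \<in> W'" using W0 unfolding W'_def by blast
    fix x y assume "x \<in> W'" "y \<in> W'"
    then obtain w z where wz: "w \<in> W" "x = w \<or> x = a + b + w" "z \<in> W" "y = z \<or> y = a + b + z"
      unfolding W'_def by blast
    have "a + b + w + (a + b + z) = w + z"
      using add_self_left[of "a + b" "w + z"] by (simp only: ac_simps)
    then have "x + y = w + z \<or> x + y = a + b + (w + z)"
      using wz(2,4) by (auto simp: ac_simps)
    then show "x + y \<in> W'"
      unfolding W'_def using Wadd[OF wz(1,3)] by (elim disjE) simp_all
  qed
  ultimately show ?case using SW by blast
qed

text \<open>Induction on the number of factors: the set where the first factor is 1 meets a flat in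
  nothing, in the whole flat, or in a flat of one dimension less.\<close>

lemma vanishes_flat:
  assumes "add_subgroup W" "card W = 2 ^ s"
  shows "vanishes s ((+) a ` W)"
proof -
  have "(\<Sum>x\<in>(+) a ` W. prod_eval ls x) = 0" if "set ls \<subseteq> L" "length ls < s" for ls
    using that assms
  proof (induction ls arbitrary: s a W)
    case Nil
    then have "even (card ((+) a ` W))" by (simp add: card_image)
    then show ?case by (simp add: of_nat_bit_eq_0_iff)
  next
    case (Cons l ls)
    have l: "l \<in> L" and ls: "set ls \<subseteq> L" using Cons.prems by auto
    have W0: "0 \<in> W" and Wadd: "x \<in> W \<Longrightarrow> y \<in> W \<Longrightarrow> x + y \<in> W" for x y
      using Cons.prems(3) by (auto simp: add_subgroup_def)
    have aff: "l (x + y) = l x + (l y + l 0)" for x y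
      using affine[OF l, of x y] by (simp add: ac_simps)
    \<comment> \<open>The directions along which \<open>l\<close> is constant, a subgroup of index 1
      or 2 in \<open>W\<close>.\<close>
    define W\<^sub>0 where "W\<^sub>0 = {w \<in> W. l w = l 0}"
    have sub: "add_subgroup W\<^sub>0"
      unfolding W\<^sub>0_def add_subgroup_def using W0 Wadd by (auto simp: aff)
    have "(\<Sum>x\<in>(+) a ` W. prod_eval (l # ls) x)
      = (\<Sum>x\<in>(+) a ` W. if l x = 1 then prod_eval ls x else 0)"
      by (intro sum.cong) auto
    also have "\<dots> = (\<Sum>x\<in>{x \<in> (+) a ` W. l x = 1}. prod_eval ls x)"
      by (rule sum.inter_filter[symmetric]) simp
    also have "\<dots> = 0"
    proof (cases "W\<^sub>0 = W")
      case True
      have "l x = l a" if x: "x \<in> (+) a ` W" for x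
      proof -
        obtain w where w: "w \<in> W" "x = a + w" using x by blast
        then have "l w = l 0" using True unfolding W\<^sub>0_def by blast
        then show ?thesis by (simp add: w(2) aff)
      qed
      then have "{x \<in> (+) a ` W. l x = 1} = (if l a = 1 then (+) a ` W else {})"
        by auto
      then show ?thesis using Cons.IH[OF ls _ Cons.prems(3,4), of a] Cons.prems(2) by simp
    next
      case False
      then obtain u where u: "u \<in> W" "l u \<noteq> l 0" unfolding W\<^sub>0_def by blast
      have Wu: "{w \<in> W. l w \<noteq> l 0} = (+) u ` W\<^sub>0"
      proof (intro equalityI subsetI)
        fix w assume w: "w \<in> {w \<in> W. l w \<noteq> l 0}"
        then have "u + w \<in> W\<^sub>0"
          using u Wadd[of u w] unfolding W\<^sub>0_def by (cases "l 0") (auto simp: aff)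
        then show "w \<in> (+) u ` W\<^sub>0" by (intro image_eqI[of _ _ "u + w"]) simp_all
      next
        fix w assume "w \<in> (+) u ` W\<^sub>0"
        then show "w \<in> {w \<in> W. l w \<noteq> l 0}"
          using u Wadd unfolding W\<^sub>0_def by (auto simp: aff)
      qed
      have "W = W\<^sub>0 \<union> {w \<in> W. l w \<noteq> l 0}" unfolding W\<^sub>0_def by blast
      then have "card W = card (W\<^sub>0 \<union> {w \<in> W. l w \<noteq> l 0})" by simp
      also have "\<dots> = card W\<^sub>0 + card {w \<in> W. l w \<noteq> l 0}"
        unfolding W\<^sub>0_def by (intro card_Un_disjoint) auto
      also have "\<dots> = 2 * card W\<^sub>0" unfolding Wu by (simp add: card_image)
      \<comment> \<open>The subtraction is not truncated: the list has a factor and is shorter than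
        \<open>s\<close>, so \<open>s\<close> is positive.\<close>
      finally have card: "card W\<^sub>0 = 2 ^ (s - 1)"
        using Cons.prems(2,4) by (cases s) auto
      \<comment> \<open>The base point must satisfy \<open>l x = 1\<close>; if \<open>a\<close> does
        not, adding \<open>u\<close> flips the value.\<close>
      have "{x \<in> (+) a ` W. l x = 1} = (+) (if l a = 1 then a else a + u) ` W\<^sub>0"
      proof (cases "l a = 1")
        case True
        then have "{x \<in> (+) a ` W. l x = 1} = (+) a ` W\<^sub>0"
          unfolding W\<^sub>0_def by (auto simp: aff)
        then show ?thesis using True by simp
      next
        case False
        then have "{x \<in> (+) a ` W. l x = 1} = (+) a ` {w \<in> W. l w \<noteq> l 0}"
          by (auto simp: aff)
        then show ?thesis unfolding Wu using False by (simp add: image_image add.assoc)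
      qed
      then show ?thesis
        using Cons.IH[OF ls _ sub card] Cons.prems(2) by simp
    qed
    finally show ?case .
  qed
  then show ?thesis unfolding vanishes_def by blast
qed


end

section \<open>Algebraic normal form\<close>

definition sqfree_monom :: "nat set \<Rightarrow> nat \<Rightarrow>\<^sub>0 nat" where
  "sqfree_monom T = (\<Sum>i\<in>T. Poly_Mapping.single i 1)"

lemma lookup_sqfree_monom: "finite T \<Longrightarrow> Poly_Mapping.lookup (sqfree_monom T) i = of_bool (i \<in> T)"
  by (simp add: sqfree_monom_def lookup_sum lookup_single when_def)

lemma keys_sqfree_monom: "finite T \<Longrightarrow> Poly_Mapping.keys (sqfree_monom T) = T"
  by (auto simp: in_keys_iff lookup_sqfree_monom)

lemma inj_on_sqfree_monom: "inj_on sqfree_monom (Collect finite)"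
  by (rule inj_onI) (metis keys_sqfree_monom mem_Collect_eq)

text \<open>A reduced polynomial over \<open>bit\<close> is determined by its set of monomials, and
  each monomial by its set of variables.\<close>

definition anf_poly :: "nat set set \<Rightarrow> F2_poly" where
  "anf_poly F = (\<Sum>T\<in>F. Poly_Mapping.single (sqfree_monom T) 1)"

definition anf_eval :: "nat set set \<Rightarrow> bit vec \<Rightarrow> bit" where
  "anf_eval F v = (\<Sum>T\<in>F. \<Prod>i\<in>T. v $ i)"

lemma lookup_anf_poly:
  assumes "F \<subseteq> Pow {..<n}"
  shows "Poly_Mapping.lookup (anf_poly F) m = of_bool (m \<in> sqfree_monom ` F)"
proof -
  have fin: "finite F" "F \<subseteq> Collect finite"
    using assms by (auto intro: finite_subset)
  have "Poly_Mapping.lookup (anf_poly F) m = (\<Sum>T\<in>F. if sqfree_monom T = m then 1 else 0)"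
    by (simp add: anf_poly_def lookup_sum lookup_single when_def)
  also have "\<dots> = (\<Sum>k\<in>sqfree_monom ` F. if k = m then 1 else 0)"
    by (subst sum.reindex) (auto intro: inj_on_subset[OF inj_on_sqfree_monom fin(2)])
  also have "\<dots> = of_bool (m \<in> sqfree_monom ` F)"
    using fin(1) by simp
  finally show ?thesis .
qed

lemma keys_anf_poly:
  assumes "F \<subseteq> Pow {..<n}"
  shows "Poly_Mapping.keys (anf_poly F) = sqfree_monom ` F"
  by (auto simp: in_keys_iff lookup_anf_poly[OF assms])

lemma finite_if_subset_Pow: "F \<subseteq> Pow {..<n::nat} \<Longrightarrow> T \<in> F \<Longrightarrow> finite T"
  by (auto intro: finite_subset)

lemma poly_eval_anf_poly:
  assumes F: "F \<subseteq> Pow {..<n}"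
  shows "poly_eval (anf_poly F) v = anf_eval F v"
proof -
  have inj: "inj_on sqfree_monom F"
    using finite_if_subset_Pow[OF F] by (auto intro: inj_on_subset[OF inj_on_sqfree_monom])
  have "poly_eval (anf_poly F) v
    = (\<Sum>T\<in>F. \<Prod>i\<in>Poly_Mapping.keys (sqfree_monom T). (v $ i) ^ Poly_Mapping.lookup (sqfree_monom T) i)"
    unfolding poly_eval_def keys_anf_poly[OF F]
    by (subst sum.reindex[OF inj]) (simp add: lookup_anf_poly[OF F])
  also have "\<dots> = anf_eval F v"
    unfolding anf_eval_def using finite_if_subset_Pow[OF F]
    by (intro sum.cong prod.cong) (auto simp: keys_sqfree_monom lookup_sqfree_monom simp del: power_bit_unfold)
  finally show ?thesis .
qed

lemma reduced_anf_poly: "F \<subseteq> Pow {..<n} \<Longrightarrow> reduced_poly n (anf_poly F)"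
  using finite_if_subset_Pow[of F n]
  by (auto simp: reduced_poly_def keys_anf_poly keys_sqfree_monom lookup_sqfree_monom)

lemma reduced_poly_imp_anf_poly:
  assumes "reduced_poly n p"
  obtains F where "F \<subseteq> Pow {..<n}" "p = anf_poly F"
proof
  let ?F = "Poly_Mapping.keys ` Poly_Mapping.keys p"
  show F: "?F \<subseteq> Pow {..<n}" using assms by (auto simp: reduced_poly_def)
  have monom: "sqfree_monom (Poly_Mapping.keys m) = m" if "m \<in> Poly_Mapping.keys p" for m
  proof (rule poly_mapping_eqI)
    fix i
    have "Poly_Mapping.lookup m i \<le> 1" using assms that by (auto simp: reduced_poly_def)
    then show "Poly_Mapping.lookup (sqfree_monom (Poly_Mapping.keys m)) i = Poly_Mapping.lookup m i"
      by (cases "Poly_Mapping.lookup m i") (auto simp: lookup_sqfree_monom in_keys_iff)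
  qed
  then have "sqfree_monom ` ?F = Poly_Mapping.keys p" by (force simp: image_image)
  then show "p = anf_poly ?F"
    by (intro poly_mapping_eqI) (auto simp: lookup_anf_poly[OF F] in_keys_iff)
qed

lemma total_deg_anf_poly_le_iff:
  assumes F: "F \<subseteq> Pow {..<n}"
  shows "total_deg (anf_poly F) \<le> r \<longleftrightarrow> (\<forall>T\<in>F. card T \<le> r)"
proof -
  have "(\<lambda>m. \<Sum>i\<in>Poly_Mapping.keys m. Poly_Mapping.lookup m i) ` Poly_Mapping.keys (anf_poly F) = card ` F"
    unfolding keys_anf_poly[OF F] image_image using finite_if_subset_Pow[OF F]
    by (intro image_cong) (auto simp: keys_sqfree_monom lookup_sqfree_monom)
  moreover have "finite F" using F by (auto intro: finite_subset)
  ultimately show ?thesis by (simp add: total_deg_def)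
qed

section \<open>Existence and uniqueness of the algebraic normal form\<close>

definition ind_vec :: "nat \<Rightarrow> nat set \<Rightarrow> bit vec" where
  "ind_vec n U = vec n (\<lambda>i. of_bool (i \<in> U))"

lemma ind_vec_carrier [simp]: "ind_vec n U \<in> carrier_vec n"
  by (simp add: ind_vec_def)

lemma carrier_vec_ind_vecE:
  assumes "v \<in> carrier_vec n"
  obtains U where "U \<subseteq> {..<n}" "v = ind_vec n U"
proof
  show "v = ind_vec n {i \<in> {..<n}. v $ i = 1}"
    using assms by (intro eq_vecI) (auto simp: ind_vec_def)
qed auto

text \<open>Points coded by subsets turn evaluation into the subset-sum transform modulo 2, which is
  triangular with respect to inclusion.\<close>

lemma anf_eval_ind_vec:
  assumes F: "F \<subseteq> Pow {..<n}"
  shows "anf_eval F (ind_vec n U) = of_nat (card {T \<in> F. T \<subseteq> U})"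
proof -
  have "(\<Prod>i\<in>T. ind_vec n U $ i) = of_bool (T \<subseteq> U)" if T: "T \<in> F" for T
  proof -
    have "i < n" if "i \<in> T" for i using T F that by blast
    then have "(\<Prod>i\<in>T. ind_vec n U $ i) = (\<Prod>i\<in>T. of_bool (i \<in> U))"
      by (intro prod.cong refl) (simp add: ind_vec_def)
    also have "\<dots> = of_bool (T \<subseteq> U)"
      using finite_if_subset_Pow[OF F T] by (cases "T \<subseteq> U") (auto intro!: prod.neutral)
    finally show ?thesis .
  qed
  moreover have "finite F" using F by (auto intro: finite_subset)
  ultimately show ?thesis by (simp add: anf_eval_def Int_def flip: sum.inter_filter)
qed

text \<open>Moebius inversion by induction on \<open>U\<close>: the value at
  \<open>ind_vec n U\<close> together with the proper subsets of \<open>U\<close> in the family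
  decides whether \<open>U\<close> belongs to it.\<close>

lemma anf_eval_inject:
  assumes F: "F \<subseteq> Pow {..<n}" and F': "F' \<subseteq> Pow {..<n}"
    and eq: "\<And>v. v \<in> carrier_vec n \<Longrightarrow> anf_eval F v = anf_eval F' v"
  shows "F = F'"
proof -
  have split: "even (card {T \<in> H. T \<subseteq> U}) \<longleftrightarrow> (U \<in> H \<longleftrightarrow> odd (card {T \<in> H. T \<subset> U}))"
    if "H \<subseteq> Pow {..<n}" for U :: "nat set" and H :: "nat set set"
  proof -
    have "finite H" using that by (auto intro: finite_subset)
    moreover have "{T \<in> H. T \<subseteq> U} = (if U \<in> H then insert U {T \<in> H. T \<subset> U} else {T \<in> H. T \<subset> U})"
      by auto
    ultimately show ?thesis by simp
  qed
  have "U \<in> F \<longleftrightarrow> U \<in> F'" if "finite U" for U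
    using that
  proof (induction U rule: finite_psubset_induct)
    case (psubset U)
    then have "{T \<in> F. T \<subset> U} = {T \<in> F'. T \<subset> U}" by blast
    moreover have "even (card {T \<in> F. T \<subseteq> U}) \<longleftrightarrow> even (card {T \<in> F'. T \<subseteq> U})"
      using eq[OF ind_vec_carrier, of U]
      unfolding anf_eval_ind_vec[OF F] anf_eval_ind_vec[OF F'] by (simp flip: of_nat_bit_eq_0_iff)
    ultimately show ?case using split[OF F, of U] split[OF F', of U] by auto
  qed
  then show ?thesis using finite_if_subset_Pow[OF F] finite_if_subset_Pow[OF F'] by blast
qed

text \<open>The map sending a set of monomials to the zero set of its polynomial is an injective
  self-map of a finite set, hence onto.\<close>

lemma anf_eval_surj:
  obtains F where "F \<subseteq> Pow {..<n}" "\<And>v. v \<in> carrier_vec n \<Longrightarrow> g v = anf_eval F v"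
proof -
  let ?N = "Pow (Pow {..<n})"
  \<comment> \<open>Coding points by subsets of \<open>{..<n}\<close> makes domain and range the
    same finite set \<open>?N\<close>.\<close>
  define \<Phi> where "\<Phi> F = {U \<in> Pow {..<n}. anf_eval F (ind_vec n U) = 1}" for F
  have "inj_on \<Phi> ?N"
  proof (rule inj_onI)
    fix F F' assume *: "F \<in> ?N" "F' \<in> ?N" "\<Phi> F = \<Phi> F'"
    show "F = F'"
    proof (rule anf_eval_inject)
      fix v :: "bit vec" assume "v \<in> carrier_vec n"
      then obtain U where U: "U \<subseteq> {..<n}" "v = ind_vec n U"
        by (rule carrier_vec_ind_vecE)
      have "U \<in> \<Phi> F \<longleftrightarrow> U \<in> \<Phi> F'" using *(3) by simp
      then have "anf_eval F v = 1 \<longleftrightarrow> anf_eval F' v = 1" using U by (simp add: \<Phi>_def)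
      then show "anf_eval F v = anf_eval F' v" by (metis bit_not_one_iff)
    qed (use * in auto)
  qed
  then have surj: "\<Phi> ` ?N = ?N"
    by (intro endo_inj_surj) (auto simp: \<Phi>_def)
  define Z where "Z = {U \<in> Pow {..<n}. g (ind_vec n U) = 1}"
  have "Z \<in> ?N" unfolding Z_def by blast
  then have "Z \<in> \<Phi> ` ?N" unfolding surj .
  then obtain F where F: "Z = \<Phi> F" "F \<in> ?N" by (rule imageE)
  have "g v = anf_eval F v" if v: "v \<in> carrier_vec n" for v
  proof -
    obtain U where U: "U \<subseteq> {..<n}" "v = ind_vec n U"
      using carrier_vec_ind_vecE[OF v] .
    have "U \<in> Z \<longleftrightarrow> U \<in> \<Phi> F" using F(1) by simp
    then have "g v = 1 \<longleftrightarrow> anf_eval F v = 1" using U by (simp add: \<Phi>_def Z_def)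
    then show ?thesis by (metis bit_not_one_iff)
  qed
  then show ?thesis using that F(2) by blast
qed

text \<open>Surjectivity of evaluation supplies the polynomial behind the definite description, and
  injectivity its uniqueness.\<close>

lemma bool_fun_deg_le_iff:
  "bool_fun_deg n g \<le> r \<longleftrightarrow>
     (\<exists>F\<subseteq>{T. T \<subseteq> {..<n} \<and> card T \<le> r}. \<forall>v\<in>carrier_vec n. g v = anf_eval F v)"
proof -
  obtain F where F: "F \<subseteq> Pow {..<n}" "\<And>v. v \<in> carrier_vec n \<Longrightarrow> g v = anf_eval F v"
    using anf_eval_surj by blast
  have "(THE p. reduced_poly n p \<and> (\<forall>v\<in>carrier_vec n. poly_eval p v = g v)) = anf_poly F"
  proof (rule the_equality)
    show "reduced_poly n (anf_poly F) \<and> (\<forall>v\<in>carrier_vec n. poly_eval (anf_poly F) v = g v)"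
      using F by (simp add: reduced_anf_poly poly_eval_anf_poly)
  next
    fix p assume p: "reduced_poly n p \<and> (\<forall>v\<in>carrier_vec n. poly_eval p v = g v)"
    then obtain F' where F': "F' \<subseteq> Pow {..<n}" "p = anf_poly F'"
      using reduced_poly_imp_anf_poly by blast
    then have "F' = F" using p F by (intro anf_eval_inject[of _ n]) (auto simp: poly_eval_anf_poly)
    then show "p = anf_poly F" using F' by simp
  qed
  then have "bool_fun_deg n g \<le> r \<longleftrightarrow> (\<forall>T\<in>F. card T \<le> r)"
    by (simp add: bool_fun_deg_def total_deg_anf_poly_le_iff[OF F(1)])
  also have "\<dots> \<longleftrightarrow> (\<exists>F\<subseteq>{T. T \<subseteq> {..<n} \<and> card T \<le> r}. \<forall>v\<in>carrier_vec n. g v = anf_eval F v)"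
  proof
    assume "\<forall>T\<in>F. card T \<le> r"
    then show "\<exists>F\<subseteq>{T. T \<subseteq> {..<n} \<and> card T \<le> r}. \<forall>v\<in>carrier_vec n. g v = anf_eval F v"
      using F by (intro exI[of _ F]) auto
  next
    assume "\<exists>F\<subseteq>{T. T \<subseteq> {..<n} \<and> card T \<le> r}. \<forall>v\<in>carrier_vec n. g v = anf_eval F v"
    then obtain F' where F': "F' \<subseteq> {T. T \<subseteq> {..<n} \<and> card T \<le> r}"
      "\<forall>v\<in>carrier_vec n. g v = anf_eval F' v" by blast
    then have "F = F'" using F by (intro anf_eval_inject[of _ n]) auto
    then show "\<forall>T\<in>F. card T \<le> r" using F'(1) by blast
  qed
  finally show ?thesis .
qed

text \<open>The map \<open>T\<close> may repeat monomials; repetitions cancel in pairs, which the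
  symmetric difference records.\<close>

lemma sum_monomials_anf_eval:
  assumes "finite I" "\<And>j. j \<in> I \<Longrightarrow> T j \<subseteq> {..<n} \<and> card (T j) \<le> k"
  shows "\<exists>F\<subseteq>{T. T \<subseteq> {..<n} \<and> card T \<le> k}. \<forall>v. anf_eval F v = (\<Sum>j\<in>I. \<Prod>i\<in>T j. v $ i)"
  using assms
proof (induction I rule: finite_induct)
  case empty
  show ?case by (intro exI[of _ "{}"]) (simp add: anf_eval_def)
next
  case (insert j I)
  then obtain F where F: "F \<subseteq> {T. T \<subseteq> {..<n} \<and> card T \<le> k}"
    "\<forall>v. anf_eval F v = (\<Sum>j\<in>I. \<Prod>i\<in>T j. v $ i)" by auto
  let ?F = "sym_diff {T j} F"
  have "F \<subseteq> Pow {..<n}" using F(1) by blast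
  then have "finite F" by (rule finite_subset) simp
  then have "anf_eval ?F v = anf_eval {T j} v + anf_eval F v" for v
    unfolding anf_eval_def by (intro sum_sym_diff_bit) simp_all
  then have "anf_eval ?F v = (\<Sum>j\<in>insert j I. \<Prod>i\<in>T j. v $ i)" for v
    using F(2) insert.hyps by (simp add: anf_eval_def)
  moreover have "?F \<subseteq> {T. T \<subseteq> {..<n} \<and> card T \<le> k}" using F(1) insert.prems by blast
  ultimately show ?case by blast
qed

lemma card_bounded_subsets: "card {T. T \<subseteq> {..<n::nat} \<and> card T \<le> r} = (\<Sum>i=0..r. n choose i)"
proof -
  have "{T. T \<subseteq> {..<n} \<and> card T \<le> r} = (\<Union>i\<in>{0..r}. {T. T \<subseteq> {..<n} \<and> card T = i})" by auto
  also have "card \<dots> = (\<Sum>i=0..r. card {T. T \<subseteq> {..<n} \<and> card T = i})"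
    by (rule card_UN_disjoint) auto
  finally show ?thesis by (simp add: n_subsets)
qed

section \<open>Kernels and generator matrices\<close>

text \<open>Rank-nullity: the echelon form has at most one pivot per row.\<close>

lemma kernel_dim_ge:
  assumes A: "(A :: 'k::field mat) \<in> carrier_mat nr nc"
  shows "nc - nr \<le> kernel.dim nc A"
proof -
  interpret kernel nr nc A by unfold_locales (rule A)
  obtain P Q where B: "gauss_jordan_single A \<in> carrier_mat nr nc"
    and ref: "row_echelon_form (gauss_jordan_single A)"
    using gauss_jordan_single[OF A refl] by blast
  have dims: "dim_row (gauss_jordan_single A) = nr" "dim_col (gauss_jordan_single A) = nc"
    using B by auto
  obtain f where "pivot_fun (gauss_jordan_single A) f nc"
    using ref unfolding row_echelon_form_def dims by blast
  note piv = pivot_positions(4)[OF B this]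
  have "card {i. i < nr \<and> row (gauss_jordan_single A) i \<noteq> 0\<^sub>v nc} \<le> card {..<nr}"
    by (intro card_mono) auto
  then show ?thesis
    using kernel_dim_code[of A] A piv by simp
qed

lemma subspace_mat_kernel:
  assumes A: "(A :: 'k::field mat) \<in> carrier_mat nr nc"
  shows "VectorSpace.subspace class_ring (mat_kernel A) (module_vec TYPE('k) nc)"
proof -
  interpret kernel nr nc A by unfold_locales (rule A)
  show ?thesis
    apply unfold_locales
    by (insert A mult_add_distrib_mat_vec[OF A] mult_mat_vec[OF A] mat_kernel[OF A], auto simp: class_ring_simps)
qed

text \<open>Encoding by \<open>transpose_mat G\<close> reaches all of \<open>C\<close> because the
  rows span it, and is injective because they are independent.\<close>

lemma generator_matrixD:
  assumes "generator_matrix N C G"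
  shows "C = {transpose_mat G *\<^sub>v v | v. v \<in> carrier_vec (dim_row G)}"
    and "inj_on (\<lambda>v. transpose_mat G *\<^sub>v v) (carrier_vec (dim_row G))"
proof -
  let ?T = "transpose_mat G" and ?r = "dim_row G"
  interpret vec_space "TYPE(bit)" N .
  have T: "?T \<in> carrier_mat N ?r"
    using assms by (auto simp: generator_matrix_def)
  have cols: "cols ?T = rows G" by simp
  have sub: "VectorSpace.subspace class_ring C V"
    using assms by (simp add: generator_matrix_def linear_code_def)
  then have subm: "submodule class_ring C V" by (rule subspace.submod)
  have C: "C \<subseteq> carrier_vec N"
    using submodule.subset[OF subm] by (simp add: module_vec_simps)
  interpret C: vectorspace class_ring "VS N C"
    using sub by (rule subspace_is_vs)
  have "C.basis (set (rows G))"
    using assms by (simp add: generator_matrix_def)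
  then have b: "C.lin_indpt (set (rows G))" "C.span (set (rows G)) = C" "set (rows G) \<subseteq> C"
    unfolding C.basis_def by simp_all
  \<comment> \<open>The basis property refers to the code as a space of its own; independence and
    span are carried over to the ambient space.\<close>
  have li: "lin_indpt (set (cols ?T))" and span: "span (set (cols ?T)) = C"
    using b span_li_not_depend[OF b(3) subm] by (simp_all add: cols)
  have dist: "distinct (cols ?T)"
    using assms by (simp add: generator_matrix_def)
  have colsN: "set (cols ?T) \<subseteq> carrier_vec N" using b(3) C by (simp add: cols)
  show "C = {?T *\<^sub>v v | v. v \<in> carrier_vec ?r}"
  proof (intro equalityI subsetI)
    fix c assume "c \<in> C"
    then obtain a where "lincomb a (set (cols ?T)) = c"
      using finite_in_span[OF _ colsN, of c] span by auto
    then have "c = ?T *\<^sub>v vec ?r (\<lambda>i. a (col ?T i))"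
      using mat_mult_eq_lincomb[OF T dist, of a] by simp
    then show "c \<in> {?T *\<^sub>v v | v. v \<in> carrier_vec ?r}" by auto
  next
    fix c assume "c \<in> {?T *\<^sub>v v | v. v \<in> carrier_vec ?r}"
    then obtain v where v: "v \<in> carrier_vec ?r" "c = ?T *\<^sub>v v" by blast
    have "c = lincomb (\<lambda>a. v $ find_first a (cols ?T)) (set (cols ?T))"
      using lincomb_eq_mat_mult[OF T v(1) dist] v(2) by simp
    then have "c \<in> span (set (cols ?T))"
      using finite_span[OF _ colsN] by auto
    then show "c \<in> C" using span by simp
  qed
  show "inj_on (\<lambda>v. ?T *\<^sub>v v) (carrier_vec ?r)"
  proof (rule inj_onI)
    fix v w assume vw: "v \<in> carrier_vec ?r" "w \<in> carrier_vec ?r" "?T *\<^sub>v v = ?T *\<^sub>v w"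
    have "?T *\<^sub>v (v - w) = ?T *\<^sub>v v - ?T *\<^sub>v w"
      by (rule mult_minus_distrib_mat_vec[OF T vw(1,2)])
    also have "\<dots> = 0\<^sub>v N"
      unfolding vw(3) using minus_cancel_vec[OF mult_mat_vec_carrier[OF T vw(2)]] .
    finally have *: "?T *\<^sub>v (v - w) = 0\<^sub>v N" .
    have "v - w \<in> carrier_vec ?r" using vw by simp
    then have "v - w = 0\<^sub>v ?r"
      using lin_depI[OF T _ _ * dist] li by (cases "v - w = 0\<^sub>v ?r") simp_all
    show "v = w"
    proof (rule eq_vecI)
      fix i assume "i < dim_vec w"
      moreover have "(v - w) $ i = 0" if "i < ?r" using that \<open>v - w = 0\<^sub>v ?r\<close> by simp
      ultimately show "v $ i = w $ i" using vw by auto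
    qed (use vw in auto)
  qed
qed

lemma card_bit_carrier_vec: "card (carrier_vec n :: bit vec set) = 2 ^ n"
proof -
  have "bij_betw (ind_vec n) (Pow {..<n}) (carrier_vec n)"
    unfolding bij_betw_def
  proof
    show "inj_on (ind_vec n) (Pow {..<n})"
    proof (rule inj_onI)
      fix U V assume UV: "U \<in> Pow {..<n}" "V \<in> Pow {..<n}" "ind_vec n U = ind_vec n V"
      have "i \<in> U \<longleftrightarrow> i \<in> V" if "i < n" for i
        using arg_cong[OF UV(3), of "\<lambda>v. v $ i"] that by (simp add: ind_vec_def of_bool_def split: if_splits)
      then show "U = V" using UV by blast
    qed
    show "ind_vec n ` Pow {..<n} = carrier_vec n"
      by (auto elim: carrier_vec_ind_vecE)
  qed
  then have "card (Pow {..<n}) = card (carrier_vec n :: bit vec set)" by (rule bij_betw_same_card)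
  then show ?thesis by (simp add: card_Pow)
qed

text \<open>Injective encoding of all messages bounds the number of rows by counting
  codewords.\<close>

lemma generator_matrix_card_le:
  assumes "generator_matrix N C G" "finite C"
  shows "2 ^ dim_row G \<le> card C"
proof -
  have "card ((\<lambda>v. transpose_mat G *\<^sub>v v) ` carrier_vec (dim_row G)) \<le> card C"
    by (intro card_mono assms(2)) (subst generator_matrixD(1)[OF assms(1)], blast)
  then show ?thesis
    by (simp add: card_image[OF generator_matrixD(2)[OF assms(1)]] card_bit_carrier_vec)
qed

text \<open>A generator matrix is a parity check matrix of the dual code, by moving
  \<open>transpose_mat G\<close> across the scalar product.\<close>

lemma generator_matrix_mult_eq_0_iff:
  assumes gen: "generator_matrix N C G" and u: "u \<in> carrier_vec N"
  shows "G *\<^sub>v u = 0\<^sub>v (dim_row G) \<longleftrightarrow> (\<forall>c\<in>C. c \<bullet> u = 0)"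
proof -
  let ?r = "dim_row G"
  have G: "G \<in> carrier_mat ?r N" using gen by (auto simp: generator_matrix_def)
  have adj: "(transpose_mat G *\<^sub>v v) \<bullet> u = v \<bullet> (G *\<^sub>v u)" if "v \<in> carrier_vec ?r" for v
    using transpose_vec_mult_scalar[OF G u that] .
  show ?thesis
  proof
    assume *: "G *\<^sub>v u = 0\<^sub>v ?r"
    show "\<forall>c\<in>C. c \<bullet> u = 0"
    proof
      fix c assume "c \<in> C"
      then obtain v where "v \<in> carrier_vec ?r" "c = transpose_mat G *\<^sub>v v"
        unfolding generator_matrixD(1)[OF gen] by blast
      then show "c \<bullet> u = 0" using adj[of v] * by simp
    qed
  next
    assume *: "\<forall>c\<in>C. c \<bullet> u = 0"
    show "G *\<^sub>v u = 0\<^sub>v ?r"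
    proof (rule eq_vecI)
      fix i assume "i < dim_vec (0\<^sub>v ?r)"
      then have i: "i < ?r" by simp
      \<comment> \<open>The message \<open>unit_vec ?r i\<close> encodes to row \<open>i\<close> of
        \<open>G\<close>.\<close>
      have "transpose_mat G *\<^sub>v unit_vec ?r i \<in> C"
        unfolding generator_matrixD(1)[OF gen] by (intro CollectI exI[of _ "unit_vec ?r i"]) simp
      then have "unit_vec ?r i \<bullet> (G *\<^sub>v u) = 0"
        using * adj[of "unit_vec ?r i"] unit_vec_carrier[of ?r i] by metis
      moreover have "unit_vec ?r i \<bullet> (G *\<^sub>v u) = (G *\<^sub>v u) $ i"
        by (rule scalar_prod_left_unit[OF mult_mat_vec_carrier[OF G u] i])
      ultimately show "(G *\<^sub>v u) $ i = 0\<^sub>v ?r $ i" using i by simp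
    qed simp
  qed
qed

section \<open>The code of a function\<close>

text \<open>Translation by 1 permutes the field, so comparing the sums of all elements gives
  \<open>2 ^ n = 0\<close> in it.\<close>

lemma add_one_self_if_card:
  assumes "CARD('a::{field, finite}) = 2 ^ n"
  shows "(1::'a) + 1 = 0"
proof -
  have "(\<Sum>x\<in>UNIV. x) = (\<Sum>x\<in>UNIV. x + (1::'a))"
    by (rule sum.reindex_bij_witness[of _ "\<lambda>x. x + 1" "\<lambda>x. x - 1"]) auto
  also have "\<dots> = (\<Sum>x\<in>UNIV. x) + of_nat CARD('a)" by (simp add: sum.distrib)
  finally have "(2::'a) ^ n = 0" by (simp add: assms)
  then show ?thesis by simp
qed

lemma vector_space_F2_scale:
  assumes "(1::'a::field) + 1 = 0"
  shows "vector_space (F2_scale :: bit \<Rightarrow> 'a \<Rightarrow> 'a)"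
proof
  fix a b :: bit and x y :: 'a
  have "x + x = 0" using assms by (metis distrib_right mult_1 mult_zero_left)
  then show "F2_scale (a + b) x = F2_scale a x + F2_scale b x"
    by (cases a; cases b) (simp_all add: F2_scale_def)
  show "F2_scale a (F2_scale b x) = F2_scale (a * b) x"
    by (cases a; cases b) (simp_all add: F2_scale_def)
qed (simp_all add: F2_scale_def distrib_left)

locale sum_free_setting =
  fixes n :: nat and bs xs :: "'a::{field, finite} list"
  assumes card_field: "CARD('a) = 2 ^ n"
    and basis: "ordered_F2_basis n bs"
    and distinct_xs: "distinct xs"
    and set_xs: "set xs = UNIV"
begin

sublocale F2: vector_space "F2_scale :: bit \<Rightarrow> 'a \<Rightarrow> 'a"
  using card_field by (intro vector_space_F2_scale add_one_self_if_card)

lemma length_bs: "length bs = n" and distinct_bs: "distinct bs"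
  and independent_bs: "F2.independent (set bs)" and span_bs: "F2.span (set bs) = UNIV"
  using basis by (auto simp: ordered_F2_basis_def)

lemma length_xs: "length xs = 2 ^ n"
  using distinct_card[OF distinct_xs] by (simp add: set_xs card_field)

lemma coord_vec_carrier [simp]: "coord_vec bs x \<in> carrier_vec n"
  by (simp add: coord_vec_def length_bs)

lemma coord_vec_nth: "i < n \<Longrightarrow> coord_vec bs x $ i = F2.representation (set bs) x (bs ! i)"
  by (simp add: coord_vec_def length_bs)

lemma coord_vec_add: "i < n \<Longrightarrow> coord_vec bs (x + y) $ i = coord_vec bs x $ i + coord_vec bs y $ i"
  by (simp add: coord_vec_nth F2.representation_add independent_bs span_bs)

lemma coord_vec_0: "i < n \<Longrightarrow> coord_vec bs 0 $ i = 0"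
  by (simp add: coord_vec_nth F2.representation_zero)

lemma coord_vec_sum: "i < n \<Longrightarrow> coord_vec bs (\<Sum>x\<in>S. h x) $ i = (\<Sum>x\<in>S. coord_vec bs (h x) $ i)"
  by (induction S rule: infinite_finite_induct) (simp_all add: coord_vec_0 coord_vec_add)

lemma coord_vec_inject:
  assumes "\<And>i. i < n \<Longrightarrow> coord_vec bs x $ i = coord_vec bs y $ i"
  shows "x = y"
proof -
  have "F2.representation (set bs) x b = F2.representation (set bs) y b" if "b \<in> set bs" for b
    using that assms by (auto simp: in_set_conv_nth length_bs coord_vec_nth)
  then have "(\<Sum>b\<in>set bs. F2_scale (F2.representation (set bs) x b) b)
    = (\<Sum>b\<in>set bs. F2_scale (F2.representation (set bs) y b) b)" by simp
  then show ?thesis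
    using F2.sum_representation_eq[OF independent_bs, of _ "set bs"] span_bs by simp
qed

text \<open>The added constants provide closure under \<open>l + 1\<close>, which complementary
  hyperplanes require.\<close>

definition coord_funs :: "('a \<Rightarrow> bit) set" where
  "coord_funs = {(\<lambda>x. coord_vec bs x $ i + c) | i c. i < n}"

lemma coord_funI: "i < n \<Longrightarrow> (\<lambda>x. coord_vec bs x $ i) \<in> coord_funs"
  unfolding coord_funs_def by (intro CollectI exI[of _ i] exI[of _ 0]) simp

sublocale affine_coordinates coord_funs
proof
  fix l x y assume "l \<in> coord_funs"
  then obtain i c where l: "l = (\<lambda>x. coord_vec bs x $ i + c)" "i < n"
    unfolding coord_funs_def by blast
  have "a + b + c = a + c + (b + c) + c" for a b :: bit by (cases c) simp_all
  then show "l (x + y) = l x + l y + l 0" unfolding l(1) by (simp add: coord_vec_add coord_vec_0 l(2))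
  have "(\<lambda>x. l x + 1) = (\<lambda>x. coord_vec bs x $ i + (c + 1))" unfolding l(1) by (simp add: add.assoc)
  then show "(\<lambda>x. l x + 1) \<in> coord_funs"
    unfolding coord_funs_def using l(2) by blast
next
  fix x y :: 'a assume "x \<noteq> y"
  then obtain i where "i < n" "coord_vec bs x $ i \<noteq> coord_vec bs y $ i"
    using coord_vec_inject[of x y] by metis
  then show "\<exists>l\<in>coord_funs. l x \<noteq> l y" by (intro bexI[OF _ coord_funI])
qed

section \<open>Affine subspaces of the field as cosets of additive subgroups\<close>

lemma subspace_iff_add_subgroup: "F2.subspace V \<longleftrightarrow> add_subgroup V"
proof
  assume "add_subgroup V"
  then show "F2.subspace V"
    unfolding F2.subspace_def add_subgroup_def by (auto simp: F2_scale_def)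
qed (auto simp: F2.subspace_def add_subgroup_def)

text \<open>An independent new vector contributes exactly one disjoint coset and so doubles the
  span.\<close>

lemma card_span: "F2.independent B \<Longrightarrow> card (F2.span B) = 2 ^ card B"
proof (induction B rule: finite_induct[OF finite])
  case 1
  then show ?case by simp
next
  case (2 b B)
  have b: "b \<notin> F2.span B" and "F2.independent B"
    using 2 by (auto simp: F2.independent_insert)
  have "F2.span (insert b B) = F2.span B \<union> (+) b ` F2.span B"
  proof (intro equalityI subsetI)
    fix x assume "x \<in> F2.span (insert b B)"
    then obtain k where "x - F2_scale k b \<in> F2.span B" unfolding F2.span_insert by blast
    then show "x \<in> F2.span B \<union> (+) b ` F2.span B"
      by (cases k) (auto simp: F2_scale_def intro: image_eqI[of _ _ "x - b"])
  next
    fix x assume "x \<in> F2.span B \<union> (+) b ` F2.span B"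
    then show "x \<in> F2.span (insert b B)"
      by (auto intro: F2.span_add F2.span_base subsetD[OF F2.span_mono[of B "insert b B"]])
  qed
  moreover have "F2.span B \<inter> (+) b ` F2.span B = {}"
  proof (rule ccontr)
    assume "F2.span B \<inter> (+) b ` F2.span B \<noteq> {}"
    then obtain y where "y \<in> F2.span B" "b + y \<in> F2.span B" by blast
    then have "b + y - y \<in> F2.span B" by (intro F2.span_diff)
    then show False using b by simp
  qed
  ultimately have "card (F2.span (insert b B)) = card (F2.span B) + card ((+) b ` F2.span B)"
    by (simp add: card_Un_disjoint)
  then show ?case using 2 \<open>F2.independent B\<close> by (simp add: card_image)
qed

lemma card_subspace:
  assumes "F2.subspace V"
  shows "card V = 2 ^ F2.dim V"
proof -
  obtain B where "B \<subseteq> V" "F2.independent B" "V \<subseteq> F2.span B" "card B = F2.dim V"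
    using F2.basis_exists by blast
  moreover from this have "F2.span B = V" using F2.span_subspace[of B V] assms by blast
  ultimately show ?thesis using card_span[of B] by simp
qed

text \<open>The size \<open>2 ^ s\<close> determines the dimension, which identifies affine
  subspaces with the flats of the vanishing argument.\<close>

lemma F2_affine_subspace_iff:
  fixes A :: "'a set"
  shows "F2_affine_subspace s A \<longleftrightarrow> (\<exists>a W. add_subgroup W \<and> card W = 2 ^ s \<and> A = (+) a ` W)"
proof -
  have eq: "F2.subspace V \<and> F2.dim V = s \<longleftrightarrow> add_subgroup V \<and> card V = 2 ^ s" for V
    using card_subspace[of V] by (auto simp: subspace_iff_add_subgroup)
  show ?thesis unfolding F2_affine_subspace_def by (simp only: conj_assoc[symmetric] eq)
qed

section \<open>Binary words as subsets of the field\<close>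

definition support :: "bit vec \<Rightarrow> 'a set" where
  "support u = (!) xs ` {i. i < 2 ^ n \<and> u $ i = 1}"

lemma inj_on_nth_xs: "inj_on ((!) xs) {..<2 ^ n}"
  using distinct_xs length_xs by (auto intro: inj_on_nth)

lemma card_support: "u \<in> carrier_vec (2 ^ n) \<Longrightarrow> card (support u) = hamming_weight u"
  unfolding support_def hamming_weight_def
  by (subst card_image) (auto intro: inj_on_subset[OF inj_on_nth_xs])

lemma sum_support:
  fixes h :: "'a \<Rightarrow> bit"
  shows "(\<Sum>i = 0..<2 ^ n. h (xs ! i) * u $ i) = (\<Sum>x\<in>support u. h x)"
proof -
  have "(\<Sum>x\<in>support u. h x) = (\<Sum>i\<in>{i. i < 2 ^ n \<and> u $ i = 1}. h (xs ! i))"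
    unfolding support_def by (subst sum.reindex) (auto intro: inj_on_subset[OF inj_on_nth_xs])
  also have "{i. i < 2 ^ n \<and> u $ i = 1} = {i \<in> {0..<2 ^ n}. u $ i = 1}" by auto
  also have "(\<Sum>i\<in>\<dots>. h (xs ! i)) = (\<Sum>i = 0..<2 ^ n. if u $ i = 1 then h (xs ! i) else 0)"
    by (rule sum.inter_filter) simp
  also have "\<dots> = (\<Sum>i = 0..<2 ^ n. h (xs ! i) * u $ i)"
    by (intro sum.cong) auto
  finally show ?thesis ..
qed

lemma support_eq_empty_iff: "u \<in> carrier_vec (2 ^ n) \<Longrightarrow> support u = {} \<longleftrightarrow> u = 0\<^sub>v (2 ^ n)"
  by (auto simp: support_def intro!: eq_vecI)

lemma support_surj:
  obtains u where "u \<in> carrier_vec (2 ^ n)" "support u = S"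
proof
  let ?u = "vec (2 ^ n) (\<lambda>i. of_bool (xs ! i \<in> S)) :: bit vec"
  show "?u \<in> carrier_vec (2 ^ n)" by simp
  show "support ?u = S"
  proof (intro equalityI subsetI)
    fix x assume "x \<in> S"
    obtain i where "i < 2 ^ n" "x = xs ! i"
      using set_xs length_xs by (metis UNIV_I in_set_conv_nth)
    then show "x \<in> support ?u" using \<open>x \<in> S\<close> unfolding support_def by auto
  next
    fix x assume "x \<in> support ?u"
    then show "x \<in> S" unfolding support_def by auto
  qed
qed

section \<open>The Reed-Muller code and its dual\<close>

abbreviation RM :: "nat \<Rightarrow> bit vec set" where
  "RM r \<equiv> reed_muller r n (map (coord_vec bs) xs)"

definition eval_vec :: "(bit vec \<Rightarrow> bit) \<Rightarrow> bit vec" where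
  "eval_vec g = vec_of_list (map g (map (coord_vec bs) xs))"

lemma eval_vec_cong:
  "(\<And>v. v \<in> carrier_vec n \<Longrightarrow> g v = h v) \<Longrightarrow> eval_vec g = eval_vec h"
  unfolding eval_vec_def by (intro arg_cong[of _ _ vec_of_list]) simp

lemma RM_eq: "RM r = (\<lambda>F. eval_vec (anf_eval F)) ` Pow {T. T \<subseteq> {..<n} \<and> card T \<le> r}"
proof (intro equalityI subsetI)
  fix c assume "c \<in> RM r"
  then obtain g F where "c = eval_vec g" "F \<subseteq> {T. T \<subseteq> {..<n} \<and> card T \<le> r}"
    "\<forall>v\<in>carrier_vec n. g v = anf_eval F v"
    unfolding reed_muller_def bool_fun_deg_le_iff eval_vec_def by blast
  then show "c \<in> (\<lambda>F. eval_vec (anf_eval F)) ` Pow {T. T \<subseteq> {..<n} \<and> card T \<le> r}"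
    using eval_vec_cong[of g "anf_eval F"] by auto
next
  fix c assume "c \<in> (\<lambda>F. eval_vec (anf_eval F)) ` Pow {T. T \<subseteq> {..<n} \<and> card T \<le> r}"
  then obtain F where "F \<subseteq> {T. T \<subseteq> {..<n} \<and> card T \<le> r}" "c = eval_vec (anf_eval F)" by auto
  then have "bool_fun_deg n (anf_eval F) \<le> r" unfolding bool_fun_deg_le_iff by blast
  then show "c \<in> RM r" unfolding reed_muller_def \<open>c = _\<close> eval_vec_def by blast
qed

lemma finite_bounded_subsets: "finite {T. T \<subseteq> {..<n} \<and> card T \<le> r}"
  by (rule finite_subset[of _ "Pow {..<n}"]) auto

text \<open>The codewords are the values of sets of monomials of degree at most \<open>r\<close>;
  this later bounds the rows of \<open>G\<close>.\<close>

lemma card_RM_le: "card (RM r) \<le> 2 ^ (\<Sum>i=0..r. n choose i)" and finite_RM: "finite (RM r)"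
proof -
  have fin: "finite (Pow {T. T \<subseteq> {..<n} \<and> card T \<le> r})" using finite_bounded_subsets by simp
  show "finite (RM r)" unfolding RM_eq using fin by (rule finite_imageI)
  show "card (RM r) \<le> 2 ^ (\<Sum>i=0..r. n choose i)"
    unfolding RM_eq using card_image_le[OF fin, of "\<lambda>F. eval_vec (anf_eval F)"]
    by (simp only: card_Pow[OF finite_bounded_subsets] card_bounded_subsets)
qed

lemma eval_vec_scalar_prod:
  assumes "u \<in> carrier_vec (2 ^ n)"
  shows "eval_vec g \<bullet> u = (\<Sum>x\<in>support u. g (coord_vec bs x))"
proof -
  have "eval_vec g \<bullet> u = (\<Sum>i = 0..<2 ^ n. g (coord_vec bs (xs ! i)) * u $ i)"
    unfolding scalar_prod_def using assms
    by (intro sum.cong) (simp_all add: eval_vec_def vec_of_list_index length_xs)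
  then show ?thesis using sum_support[of "\<lambda>x. g (coord_vec bs x)" u] by simp
qed

text \<open>Multiplying by a coordinate plus a constant raises the degree by at most one, since
  squares of variables reduce.\<close>

lemma prod_eval_eq_anf_eval:
  assumes "set ls \<subseteq> coord_funs"
  shows "\<exists>F\<subseteq>{T. T \<subseteq> {..<n} \<and> card T \<le> length ls}. \<forall>x. prod_eval ls x = anf_eval F (coord_vec bs x)"
  using assms
proof (induction ls)
  case Nil
  show ?case by (intro exI[of _ "{{}}"]) (simp add: anf_eval_def)
next
  case (Cons l ls)
  then obtain F where F: "F \<subseteq> {T. T \<subseteq> {..<n} \<and> card T \<le> length ls}"
    "\<And>x. prod_eval ls x = anf_eval F (coord_vec bs x)" by auto
  obtain i c where l: "l = (\<lambda>x. coord_vec bs x $ i + c)" "i < n"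
    using Cons.prems unfolding coord_funs_def by auto
  have finF: "finite F" using F(1) finite_bounded_subsets by (rule finite_subset)
  have finT: "finite T" if "T \<in> F" for T
    using that F(1) by (intro finite_subset[of T "{..<n}"]) auto
  \<comment> \<open>Multiplication by variable \<open>i\<close> sends \<open>T\<close> to
    \<open>insert i T\<close>; sets differing only in \<open>i\<close> collide and cancel.\<close>
  have "\<exists>F1\<subseteq>{T. T \<subseteq> {..<n} \<and> card T \<le> Suc (length ls)}.
      \<forall>v. anf_eval F1 v = (\<Sum>T\<in>F. \<Prod>j\<in>insert i T. v $ j)"
  proof (rule sum_monomials_anf_eval[OF finF])
    fix T assume "T \<in> F"
    then show "insert i T \<subseteq> {..<n} \<and> card (insert i T) \<le> Suc (length ls)"
      using F(1) l(2) card_insert_le_m1[of "Suc (length ls)" T i] by auto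
  qed
  then obtain F1 where F1: "F1 \<subseteq> {T. T \<subseteq> {..<n} \<and> card T \<le> Suc (length ls)}"
    "\<And>v. anf_eval F1 v = (\<Sum>T\<in>F. \<Prod>j\<in>insert i T. v $ j)" by blast
  have idem: "b * b = b" for b :: bit by (cases b) simp_all
  have prod: "(\<Prod>j\<in>insert i T. v $ j) = v $ i * (\<Prod>j\<in>T. v $ j)" if "T \<in> F" for T and v :: "bit vec"
  proof (cases "i \<in> T")
    case True
    have "(\<Prod>j\<in>T. v $ j) = v $ i * (\<Prod>j\<in>T - {i}. v $ j)"
      using finT[OF that] True by (rule prod.remove)
    then have "v $ i * (\<Prod>j\<in>T. v $ j) = (\<Prod>j\<in>T. v $ j)"
      by (simp add: idem flip: mult.assoc)
    then show ?thesis using True by (simp add: insert_absorb)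
  next
    case False
    then show ?thesis using finT[OF that] by simp
  qed
  have F1': "anf_eval F1 v = v $ i * anf_eval F v" for v
    by (simp only: F1(2) anf_eval_def[of F] sum_distrib_left prod cong: sum.cong)
  \<comment> \<open>For \<open>c = 1\<close> the product is \<open>v $ i\<close> times the old
    polynomial plus the old polynomial itself.\<close>
  let ?F = "if c = 0 then F1 else sym_diff F1 F"
  have finF1: "finite F1" using F1(1)
    by (rule finite_subset) (rule finite_subset[of _ "Pow {..<n}"], auto)
  have "prod_eval (l # ls) x = anf_eval ?F (coord_vec bs x)" for x
  proof (cases "c = 0")
    case True
    then show ?thesis by (simp add: l F(2) F1')
  next
    case False
    then have "anf_eval ?F v = anf_eval F1 v + anf_eval F v" for v
      unfolding anf_eval_def using sum_sym_diff_bit[OF finF1 finF] by simp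
    then show ?thesis using False by (simp add: l F(2) F1' distrib_right)
  qed
  moreover have "?F \<subseteq> {T. T \<subseteq> {..<n} \<and> card T \<le> length (l # ls)}"
    using F(1) F1(1) by auto
  ultimately show ?case by blast
qed

text \<open>Products of at most \<open>r\<close> affine coordinates have degree at most
  \<open>r\<close>, and the monomials spanning \<open>RM r\<close> are such products. At most
  \<open>r\<close> factors means fewer than \<open>Suc r\<close>.\<close>

lemma orthogonal_RM_iff:
  assumes u: "u \<in> carrier_vec (2 ^ n)"
  shows "(\<forall>c\<in>RM r. c \<bullet> u = 0) \<longleftrightarrow> vanishes (Suc r) (support u)"
proof
  assume orth: "\<forall>c\<in>RM r. c \<bullet> u = 0"
  show "vanishes (Suc r) (support u)"
    unfolding vanishes_def
  proof (intro allI impI)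
    fix ls assume ls: "set ls \<subseteq> coord_funs" "length ls < Suc r"
    obtain F where F: "F \<subseteq> {T. T \<subseteq> {..<n} \<and> card T \<le> length ls}"
      "\<And>x. prod_eval ls x = anf_eval F (coord_vec bs x)"
      using prod_eval_eq_anf_eval[OF ls(1)] by blast
    have "F \<subseteq> {T. T \<subseteq> {..<n} \<and> card T \<le> r}" using F(1) ls(2) by fastforce
    then have "eval_vec (anf_eval F) \<in> RM r" unfolding RM_eq by blast
    then have "eval_vec (anf_eval F) \<bullet> u = 0" using orth by blast
    then show "(\<Sum>x\<in>support u. prod_eval ls x) = 0"
      by (simp add: eval_vec_scalar_prod[OF u] F(2))
  qed
next
  assume van: "vanishes (Suc r) (support u)"
  show "\<forall>c\<in>RM r. c \<bullet> u = 0"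
  proof
    fix c assume "c \<in> RM r"
    then obtain F where F: "F \<subseteq> {T. T \<subseteq> {..<n} \<and> card T \<le> r}" "c = eval_vec (anf_eval F)"
      unfolding RM_eq by auto
    have "c \<bullet> u = (\<Sum>x\<in>support u. \<Sum>T\<in>F. \<Prod>i\<in>T. coord_vec bs x $ i)"
      by (simp add: F(2) eval_vec_scalar_prod[OF u] anf_eval_def)
    also have "\<dots> = (\<Sum>T\<in>F. \<Sum>x\<in>support u. \<Prod>i\<in>T. coord_vec bs x $ i)"
      by (rule sum.swap)
    also have "\<dots> = 0"
    proof (rule sum.neutral, rule ballI)
      fix T assume "T \<in> F"
      then have T: "T \<subseteq> {..<n}" "card T \<le> r" using F(1) by auto
      then have fin: "finite T" by (auto intro: finite_subset)
      let ?ls = "map (\<lambda>i x. coord_vec bs x $ i) (sorted_list_of_set T)"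
      have "prod_eval ?ls x = (\<Prod>i\<in>T. coord_vec bs x $ i)" for x
        using prod.distinct_set_conv_list[of "sorted_list_of_set T" "\<lambda>i. coord_vec bs x $ i"] fin
        by (simp add: comp_def)
      moreover have "set ?ls \<subseteq> coord_funs" "length ?ls < Suc r"
        using T fin coord_funI by auto
      then have "(\<Sum>x\<in>support u. prod_eval ?ls x) = 0" by (rule vanishesD[OF van])
      ultimately show "(\<Sum>x\<in>support u. \<Prod>i\<in>T. coord_vec bs x $ i) = 0" by simp
    qed
    finally show "c \<bullet> u = 0" .
  qed
qed

text \<open>Coordinates are additive, so this block of the parity check computes the coordinates of
  the sum of \<open>f\<close> over the support.\<close>

lemma mat_of_cols_mult_eq_0_iff:
  assumes u: "u \<in> carrier_vec (2 ^ n)"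
  shows "mat_of_cols (length bs) (map (\<lambda>x. coord_vec bs (f x)) xs) *\<^sub>v u = 0\<^sub>v n
    \<longleftrightarrow> (\<Sum>x\<in>support u. f x) = 0"
proof -
  let ?M = "mat_of_cols (length bs) (map (\<lambda>x. coord_vec bs (f x)) xs)"
  have nth: "(?M *\<^sub>v u) $ i = coord_vec bs (\<Sum>x\<in>support u. f x) $ i" if i: "i < n" for i
  proof -
    have "(?M *\<^sub>v u) $ i = (\<Sum>j = 0..<2 ^ n. coord_vec bs (f (xs ! j)) $ i * u $ j)"
      using i u by (simp add: length_bs scalar_prod_def length_xs mat_of_cols_index)
    then show ?thesis
      using sum_support[of "\<lambda>x. coord_vec bs (f x) $ i" u] by (simp add: coord_vec_sum[OF i])
  qed
  have dim: "dim_vec (?M *\<^sub>v u) = n" by (simp add: length_bs)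
  show ?thesis
  proof
    assume *: "?M *\<^sub>v u = 0\<^sub>v n"
    show "(\<Sum>x\<in>support u. f x) = 0"
      by (rule coord_vec_inject) (simp add: coord_vec_0 * flip: nth)
  next
    assume "(\<Sum>x\<in>support u. f x) = 0"
    then show "?M *\<^sub>v u = 0\<^sub>v n"
      using nth dim by (intro eq_vecI) (simp_all add: coord_vec_0)
  qed
qed

lemma mem_sum_free_code_iff:
  assumes gen: "generator_matrix (2 ^ n) (RM r) G"
  shows "u \<in> sum_free_code G bs xs f \<longleftrightarrow>
    u \<in> carrier_vec (2 ^ n) \<and> vanishes (Suc r) (support u) \<and> (\<Sum>x\<in>support u. f x) = 0"
proof -
  let ?M = "mat_of_cols (length bs) (map (\<lambda>x. coord_vec bs (f x)) xs)"
  have G: "G \<in> carrier_mat (dim_row G) (2 ^ n)" using gen by (auto simp: generator_matrix_def)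
  have M: "?M \<in> carrier_mat n (2 ^ n)"
    using mat_of_cols_carrier(1)[of "length bs" "map (\<lambda>x. coord_vec bs (f x)) xs"]
    by (simp add: length_bs length_xs)
  have "(G @\<^sub>r ?M) *\<^sub>v u = 0\<^sub>v (dim_row G + n) \<longleftrightarrow>
    G *\<^sub>v u = 0\<^sub>v (dim_row G) \<and> ?M *\<^sub>v u = 0\<^sub>v n" if u: "u \<in> carrier_vec (2 ^ n)"
  proof -
    have "0\<^sub>v (dim_row G + n) = (0\<^sub>v (dim_row G) @\<^sub>v 0\<^sub>v n :: bit vec)"
      by (intro eq_vecI) auto
    then show ?thesis
      unfolding mat_mult_append[OF G M u]
      using append_vec_eq[OF mult_mat_vec_carrier[OF G u] zero_carrier_vec] by simp
  qed
  then show ?thesis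
    unfolding sum_free_code_def mat_kernel[OF carrier_append_rows[OF G M]]
    using generator_matrix_mult_eq_0_iff[OF gen, of u] orthogonal_RM_iff[of u r] mat_of_cols_mult_eq_0_iff[of u f]
    by auto
qed

section \<open>Sum-freedom and minimum distance\<close>

text \<open>A smaller \<open>S\<close> would be a flat on which \<open>f\<close> sums to zero. The
  remaining gain is parity from 3 to 4 for \<open>s = 1\<close>, and an empty complement for
  \<open>s = n - 1\<close>.\<close>

lemma card_support_ge:
  assumes sf: "sum_free_of_order s f" and s: "1 \<le> s" "s \<le> n - 1"
    and S: "vanishes s S" "S \<noteq> {}" "(\<Sum>x\<in>S. f x) = 0"
  shows "(if s = 1 then 4 else if s \<le> n - 2 then 2 ^ s + 2 ^ (s - 1) else 2 ^ n) \<le> card S"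
proof -
  obtain t where t: "s = Suc t" using s(1) by (cases s) auto
  have not_flat: "\<not> F2_affine_subspace s S"
    using sf S(3) unfolding sum_free_of_order_def by blast
  then have ge: "3 * 2 ^ s \<le> 2 * card S"
    using flat_if_vanishes[OF S(1,2)] unfolding F2_affine_subspace_iff by force
  \<comment> \<open>For \<open>n = 2\<close> the extreme cases coincide, and
    \<open>4 = 2 ^ n\<close> makes their bounds agree.\<close>
  consider "s = 1" | "s \<noteq> 1" "s \<le> n - 2" | "s \<noteq> 1" "s = n - 1" using s by linarith
  then show ?thesis
  proof cases
    case 1
    then have "even (card S)" using even_card_if_vanishes[of 0 S] S(1) by simp
    then have "card S \<noteq> 3" by auto
    then show ?thesis using ge 1 by simp
  next
    case 2
    then show ?thesis using ge t by simp
  next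
    case 3
    then have n: "n = Suc s" using s by simp
    \<comment> \<open>The whole field is a flat of dimension \<open>n\<close>, so the complement of
      \<open>S\<close> inherits vanishing to order \<open>s\<close>.\<close>
    have UNIV: "vanishes s (UNIV :: 'a set)"
      using vanishes_mono[OF vanishes_flat[of UNIV n 0], of s] n card_field by (simp add: add_subgroup_def)
    have "vanishes s (- S)"
      unfolding vanishes_def
    proof (intro allI impI)
      fix ls assume "set ls \<subseteq> coord_funs" "length ls < s"
      then have "sum (prod_eval ls) UNIV = 0" "sum (prod_eval ls) S = 0"
        using vanishesD[OF UNIV] vanishesD[OF S(1)] by blast+
      then show "sum (prod_eval ls) (- S) = 0"
        using sum.subset_diff[of S UNIV "prod_eval ls"] by (simp add: Compl_eq_Diff_UNIV)
    qed
    then have "2 ^ s \<le> card (- S)" if "S \<noteq> UNIV"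
      using that by (intro card_ge_if_vanishes) auto
    moreover have "card S + card (- S) = 2 ^ n"
      using card_subset_Diff[of S UNIV] card_field by (simp add: Compl_eq_Diff_UNIV)
    moreover have "0 < (2::nat) ^ s" by simp
    \<comment> \<open>By \<open>ge\<close> the complement has at most a quarter of the
      \<open>2 ^ n\<close> points, whereas a nonempty one would have at least half.\<close>
    ultimately have "S = UNIV" using ge n by (cases "S = UNIV") (simp_all del: zero_less_power)
    then have "card S = 2 ^ n" by (simp only: card_field)
    then show ?thesis using 3(1) n by simp
  qed
qed

text \<open>Forwards, the dimension comes from counting parity checks and the distance from the
  supports. Backwards, a flat with zero sum is the support of a codeword that is too light.\<close>

lemma sum_free_of_order_iff_code:
  assumes s: "1 \<le> s" "s \<le> n - 1"
    and gen: "generator_matrix (2 ^ n) (RM (s - 1)) G"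
  shows "sum_free_of_order s f \<longleftrightarrow>
    (\<exists>k d. is_code (2 ^ n) k d (sum_free_code G bs xs f)
       \<and> int k \<ge> 2 ^ n - int n - (\<Sum>i = 0..s - 1. int (n choose i))
       \<and> d \<ge> (if s = 1 then 4 else if s \<le> n - 2 then 2 ^ s + 2 ^ (s - 1) else 2 ^ n))"
    (is "_ \<longleftrightarrow> (\<exists>k d. _ \<and> _ \<and> d \<ge> ?bound)")
proof -
  let ?C = "sum_free_code G bs xs f"
  have mem: "u \<in> ?C \<longleftrightarrow> u \<in> carrier_vec (2 ^ n) \<and> vanishes s (support u) \<and> (\<Sum>x\<in>support u. f x) = 0" for u
    using mem_sum_free_code_iff[OF gen] s(1) by simp
  show ?thesis
  proof
    assume sf: "sum_free_of_order s f"
    let ?H = "G @\<^sub>r mat_of_cols (length bs) (map (\<lambda>x. coord_vec bs (f x)) xs)"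
    have H: "?H \<in> carrier_mat (dim_row G + n) (2 ^ n)"
      using gen length_bs length_xs
      by (intro carrier_append_rows) (auto simp: generator_matrix_def)
    have C: "?C = mat_kernel ?H" by (simp add: sum_free_code_def)
    interpret K: kernel "dim_row G + n" "2 ^ n" ?H by unfold_locales (rule H)
    define k where "k = K.dim"
    have "(2::nat) ^ dim_row G \<le> 2 ^ (\<Sum>i=0..s-1. n choose i)"
      using generator_matrix_card_le[OF gen finite_RM] card_RM_le[of "s - 1"] by linarith
    then have rows: "dim_row G \<le> (\<Sum>i=0..s-1. n choose i)" by simp
    have dim: "2 ^ n \<le> k + dim_row G + n" using kernel_dim_ge[OF H] by (simp add: k_def)
    have k: "int k \<ge> 2 ^ n - int n - (\<Sum>i = 0..s - 1. int (n choose i))"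
    proof -
      have "int (2 ^ n) \<le> int (k + n + (\<Sum>i=0..s-1. n choose i))" using dim rows by linarith
      then show ?thesis by simp
    qed
    \<comment> \<open>Since \<open>s - 1\<close> is at most \<open>n - 2\<close>, the binomials at
      \<open>n - 1\<close> and \<open>n\<close>, which add up to \<open>n + 1\<close>, are still
      left in the row sum \<open>2 ^ n\<close>.\<close>
    have "(\<Sum>i=0..s-1. n choose i) + (n + 1) \<le> 2 ^ n"
    proof -
      have "(\<Sum>i\<in>{0..s-1} \<union> {n-1, n}. n choose i) \<le> (\<Sum>i\<le>n. n choose i)"
        using s by (intro sum_mono2) auto
      moreover have "(\<Sum>i\<in>{0..s-1} \<union> {n-1, n}. n choose i) = (\<Sum>i=0..s-1. n choose i) + (\<Sum>i\<in>{n-1, n}. n choose i)"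
        using s by (intro sum.union_disjoint) auto
      moreover have "n choose (n - 1) = n" using s binomial_symmetric[of 1 n] by simp
      ultimately show ?thesis using s by (simp add: choose_row_sum)
    qed
    then have "k \<noteq> 0" using dim rows by linarith
    \<comment> \<open>\<open>is_code\<close> asks for a nonzero word attaining the minimum weight,
      so positive dimension has to be turned into such a word.\<close>
    have "\<exists>u\<in>?C. u \<noteq> 0\<^sub>v (2 ^ n)"
    proof (rule ccontr)
      assume "\<not> (\<exists>u\<in>?C. u \<noteq> 0\<^sub>v (2 ^ n))"
      moreover have "0\<^sub>v (2 ^ n) \<in> mat_kernel ?H" by (rule K.Ker.zero_closed)
      ultimately have ker: "mat_kernel ?H = {0\<^sub>v (2 ^ n)}" unfolding C by blast
      then have sub: "{0\<^sub>v (2 ^ n)} \<subseteq> mat_kernel ?H" by (rule equalityD2)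
      have "K.span {0\<^sub>v (2 ^ n)} = mat_kernel ?H"
      proof (rule antisym)
        show "K.span {0\<^sub>v (2 ^ n)} \<subseteq> mat_kernel ?H" by (rule K.Ker.span_is_subset2[OF sub])
        show "mat_kernel ?H \<subseteq> K.span {0\<^sub>v (2 ^ n)}" 
          by (rule ord_eq_le_trans[OF ker K.Ker.in_own_span[OF sub]])
      qed
      then have "K.dim = 0" by (rule K.Ker.dim0I)
      then show False using \<open>k \<noteq> 0\<close> k_def by simp
    qed
    then obtain u where u: "u \<in> ?C \<and> u \<noteq> 0\<^sub>v (2 ^ n)"
      and min: "\<forall>v. v \<in> ?C \<and> v \<noteq> 0\<^sub>v (2 ^ n) \<longrightarrow> hamming_weight u \<le> hamming_weight v"
      using ex_has_least_nat[of "\<lambda>u. u \<in> ?C \<and> u \<noteq> 0\<^sub>v (2 ^ n)" _ hamming_weight] by blast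
    have "linear_code (2 ^ n) ?C"
      unfolding linear_code_def C by (rule subspace_mat_kernel[OF H])
    then have "is_code (2 ^ n) k (hamming_weight u) ?C"
      using u min unfolding is_code_def k_def C by auto
    moreover have "?bound \<le> hamming_weight u"
      using card_support_ge[OF sf s, of "support u"] u mem[of u] card_support[of u] support_eq_empty_iff[of u]
      by auto
    ultimately show "\<exists>k d. is_code (2 ^ n) k d ?C
       \<and> int k \<ge> 2 ^ n - int n - (\<Sum>i = 0..s - 1. int (n choose i)) \<and> d \<ge> ?bound"
      using k by blast
  next
    assume "\<exists>k d. is_code (2 ^ n) k d ?C
       \<and> int k \<ge> 2 ^ n - int n - (\<Sum>i = 0..s - 1. int (n choose i)) \<and> d \<ge> ?bound"
    then obtain k d where code: "is_code (2 ^ n) k d ?C" and d: "?bound \<le> d" by blast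
    show "sum_free_of_order s f"
      unfolding sum_free_of_order_def
    proof (intro allI impI notI)
      fix A assume "F2_affine_subspace s A" and sum: "(\<Sum>x\<in>A. f x) = 0"
      then obtain a W where W: "add_subgroup W" "card W = 2 ^ s" "A = (+) a ` W"
        unfolding F2_affine_subspace_iff by blast
      obtain u where u: "u \<in> carrier_vec (2 ^ n)" "support u = A" using support_surj .
      have card: "card A = 2 ^ s" using W by (simp add: card_image)
      have "vanishes s A" unfolding W(3) by (rule vanishes_flat[OF W(1,2)])
      then have "u \<in> ?C" unfolding mem u(2) using u(1) sum by blast
      moreover have "A \<noteq> {}" using card by auto
      then have "u \<noteq> 0\<^sub>v (2 ^ n)" using support_eq_empty_iff[OF u(1)] u(2) by blast
      ultimately have "d \<le> 2 ^ s"
        using code card_support[OF u(1)] u(2) card unfolding is_code_def by auto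
      \<comment> \<open>The three branches read \<open>2 < 4\<close>,
        \<open>2 ^ s < 2 ^ s + 2 ^ (s - 1)\<close> and \<open>2 ^ (n - 1) < 2 ^ n\<close>.\<close>
      moreover have "2 ^ s < ?bound" using s by (auto intro: power_strict_increasing)
      ultimately show False using d by linarith
    qed
  qed
qed

end

theorem theorem4p5:
  fixes f :: "'a::{field, finite} \<Rightarrow> 'a"
    and n s :: nat
    and bs xs :: "'a list"
    and G :: "bit mat"
  assumes "CARD('a) = 2 ^ n"
    and "1 \<le> s" and "s \<le> n - 1"
    and "ordered_F2_basis n bs"
    and "distinct xs" and "set xs = UNIV"
    and "generator_matrix (2 ^ n) (reed_muller (s - 1) n (map (coord_vec bs) xs)) G"
  shows "sum_free_of_order s f \<longleftrightarrow>
    (\<exists>k d. is_code (2 ^ n) k d (sum_free_code G bs xs f)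
       \<and> int k \<ge> 2 ^ n - int n - (\<Sum>i = 0..s - 1. int (n choose i))
       \<and> d \<ge> (if s = 1 then 4 else if s \<le> n - 2 then 2 ^ s + 2 ^ (s - 1) else 2 ^ n))"
proof -
  interpret sum_free_setting n bs xs by unfold_locales (use assms in auto)
  show ?thesis using sum_free_of_order_iff_code assms by blast
qed

end
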